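(* Let $F\in\mathbb{Z}[x,y]$ be $\sigma$-invariant and of (total) degree $N$. Then $$\int_\Delta\frac{F\,dx\,dy}{1-x^2-y^2}=a_F+b_F\,\mathbf{G},$$ where $a_F$ and $b_F$ are rational numbers such that $2^N b_F$ and $2^{N+2}L_N L_{N/2}\,a_F$ are integers.
   Context: $\mathbf{G}=1-\frac1{3^2}+\frac1{5^2}-\frac1{7^2}+\cdots$ is the Catalan constant. $\Delta=\{(x,y)\in\mathbb{R}^2:x,y,1-x-y\ge0\}$. $\sigma$ is the ring automorphism of $\mathbb{Z}[x,y]$ with $(x,y)\mapsto(-y,x)$, and $\sigma$-invariant means $\sigma F=F$; $\sigma$-invariance forces $N$ to be even. For a positive integer $m$, $L_m$ is the least common multiple of $1,\dots,m$; $L_0=1$. *)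

theory Defs
  imports "HOL-Analysis.Analysis" "HOL-Computational_Algebra.Polynomial"
begin

(* An element of \<int>[x,y] is an int poly poly: the coefficients are polynomials in x,
   the outer variable is y, so coeff (coeff F j) i is the coefficient of x^i y^j. *)

definition var_x :: "int poly poly" where
  "var_x = [:[:0, 1:]:]"

definition var_y :: "int poly poly" where
  "var_y = [:0, 1:]"

(* The value F(a, b) in an arbitrary commutative ring. *)
definition eval2 :: "int poly poly \<Rightarrow> 'a::comm_ring_1 \<Rightarrow> 'a \<Rightarrow> 'a" where
  "eval2 F a b = poly (map_poly (\<lambda>p. poly (map_poly of_int p) a) F) b"

(* The insert makes the degree of the zero polynomial 0. *)
definition total_degree :: "int poly poly \<Rightarrow> nat" where
  "total_degree F = Max (insert 0 {i + j |i j. coeff (coeff F j) i \<noteq> 0})"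

definition sigma_aut :: "int poly poly \<Rightarrow> int poly poly" where
  "sigma_aut F = eval2 F (- var_y) var_x"

lemma sigma_aut_var_x: "sigma_aut var_x = - var_y"
  by (simp add: sigma_aut_def eval2_def var_x_def var_y_def map_poly_pCons)

lemma sigma_aut_var_y: "sigma_aut var_y = var_x"
  by (simp add: sigma_aut_def eval2_def var_x_def var_y_def map_poly_pCons)

definition Delta :: "(real \<times> real) set" where
  "Delta = {(x, y). x \<ge> 0 \<and> y \<ge> 0 \<and> 1 - x - y \<ge> 0}"

definition Catalan_G :: real where
  "Catalan_G = (\<Sum>k. (- 1) ^ k / real (2 * k + 1) ^ 2)"

definition lcm_upto :: "nat \<Rightarrow> nat" where
  "lcm_upto m = Lcm {1..m}"

end

theory Submission
  imports Defs "HOL-Real_Asymp.Real_Asymp"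
begin

text \<open>Write \<rho> = x^2 + y^2 and z = x + \<i> y, and let T f be the integral of f/(1 - \<rho>) over \<Delta>.
Since 2x and 2\<i>y are z + z' and z - z' (with z' the conjugate of z), a monomial x^i y^j with
i + j = 2n and j even is 2^(-2n) times an integer combination of the Re (z^p z'^q) with p + q = 2n.
It therefore suffices to know T on these functions, and two relations determine it there.

\<^item> Multiplying by \<rho> changes T f by the integral of f over \<Delta> without the weight. As
  z z' = \<rho>, this lowers p and q together, down to a pure power of z. The correction is an integral
  of an integer form of degree d over the triangle, which is an integer divided by (d + 2) L_(d+1)
  (\<open>weighted_integral_radius\<close>, \<open>lcm_upto_times_Delta_integral\<close>).
\<^item> The rotation field D = x \<partial>/\<partial>y - y \<partial>/\<partial>x annihilates the weight, so T (D h) is a boundary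
  integral. If h vanishes on both axes, only the hypotenuse x + y = 1 contributes, and there
  1 - \<rho> = 2xy cancels against h, so that a rational Beta integral is left
  (\<open>weighted_integral_rot_monomial\<close>). For even p > 0 the form h = Im z^p is a multiple of xy and
  D h = p Re z^p. Hence 2p L_p T (Re z^p) is an integer (\<open>radial_integral_power\<close>).

What these relations leave over is T 1, which equals G (\<open>nn_integral_circle_kernel\<close>).
Collecting denominators, T (Re (z^p z'^q)) is an integer multiple of G plus a rational number with
denominator dividing 4 L_(2n) L_n (\<open>radial_integral_lattice\<close>), and the powers of 2 come from
passing from x, y to z, z'.

It remains to see that only the monomials with both exponents even matter. Invariance under \<sigma>
gives F(x,y) = F(-x,-y) and F(-x,y) = F(y,x), while \<Delta> and the weight are symmetric under exchanging x
and y. So T F is also T of the average of F over the four sign changes of x and y, which removes every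
monomial with an odd exponent (\<open>weighted_integral_invariant\<close>).\<close>

section \<open>Beta integrals and least common multiples\<close>

text \<open>The value at (i+1, j+1) of the Beta function.\<close>
definition beta_nat :: "nat \<Rightarrow> nat \<Rightarrow> real" where
  "beta_nat i j = fact i * fact j / fact (i + j + 1)"

lemma beta_nat_0: "beta_nat i 0 = 1 / real (i + 1)"
  by (simp add: beta_nat_def)

lemma beta_nat_Suc_right: "beta_nat i (Suc j) = beta_nat i j - beta_nat (Suc i) j"
  by (simp add: beta_nat_def divide_simps) (simp add: algebra_simps)

lemma has_integral_beta_nat:
  "((\<lambda>t. t ^ i * (1 - t) ^ j) has_integral beta_nat i j) {0..1}"
proof (induction j arbitrary: i)
  case 0
  have "((\<lambda>t. t ^ i) has_integral (1 ^ Suc i / real (Suc i) - 0 ^ Suc i / real (Suc i))) {0..1::real}"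
    by (intro fundamental_theorem_of_calculus)
       (auto intro!: derivative_eq_intros simp flip: has_real_derivative_iff_has_vector_derivative
          simp del: of_nat_Suc power_Suc)
  then show ?case by (simp add: beta_nat_0 add.commute)
next
  case (Suc j)
  have "((\<lambda>t. t ^ i * (1 - t) ^ j - t ^ Suc i * (1 - t) ^ j)
      has_integral (beta_nat i j - beta_nat (Suc i) j)) {0..1}"
    by (intro has_integral_diff Suc.IH)
  then show ?case
    by (simp add: beta_nat_Suc_right algebra_simps)
qed

lemma lcm_upto_pos: "lcm_upto m > 0"
  unfolding lcm_upto_def by (metis Lcm_0_iff_nat atLeastAtMost_iff finite_atLeastAtMost gr0I not_one_le_zero)

lemma dvd_lcm_upto: "1 \<le> k \<Longrightarrow> k \<le> m \<Longrightarrow> k dvd lcm_upto m"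
  by (simp add: lcm_upto_def dvd_Lcm)

lemma lcm_upto_dvd_mono: "m \<le> n \<Longrightarrow> lcm_upto m dvd lcm_upto n"
  unfolding lcm_upto_def by (intro Lcm_subset) auto

lemma Ints_of_nat_dvd_mult:
  fixes x :: real
  assumes "m dvd n" "real m * x \<in> \<int>"
  shows "real n * x \<in> \<int>"
proof -
  obtain k where "n = m * k" using assms(1) by blast
  then have "real n * x = of_nat k * (real m * x)" by simp
  then show ?thesis using assms(2) by (metis Ints_mult Ints_of_nat)
qed

text \<open>The recurrence for beta_nat i (j+1) reduces the exponent of 1 - t without raising i + j, until only
the reciprocals 1/(k+1) with k + 1 \<le> m are left; this avoids expanding (1 - t)^j.\<close>
lemma lcm_upto_times_beta_nat:
  assumes "i + j < m"
  shows "real (lcm_upto m) * beta_nat i j \<in> \<int>"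
  using assms
proof (induction j arbitrary: i)
  case 0
  have "real (i + 1) * beta_nat i 0 \<in> \<int>"
    unfolding beta_nat_0 by simp
  moreover have "i + 1 dvd lcm_upto m"
    using 0 by (intro dvd_lcm_upto) auto
  ultimately show ?case by (rule Ints_of_nat_dvd_mult[rotated])
next
  case (Suc j)
  then show ?case
    by (auto simp: beta_nat_Suc_right right_diff_distrib intro!: Ints_diff)
qed

section \<open>Catalan's constant as the integral of the weight\<close>

lemma Delta_eq: "Delta = {z. 0 \<le> fst z \<and> 0 \<le> snd z \<and> fst z + snd z \<le> 1}"
  by (auto simp: Delta_def)

lemma compact_Delta: "compact Delta"
proof -
  have "closed Delta"
    unfolding Delta_eq by (intro closed_Collect_conj closed_Collect_le continuous_intros)
  moreover have "Delta \<subseteq> cbox (0,0) (1,1)"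
    by (auto simp: Delta_def)
  ultimately show ?thesis
    by (metis bounded_cbox bounded_subset compact_eq_bounded_closed)
qed

lemma Delta_measurable [measurable]: "Delta \<in> sets borel"
  using compact_Delta by (simp add: borel_compact)

lemma nn_integral_Delta:
  assumes "f \<in> borel_measurable borel"
  shows "(\<integral>\<^sup>+z. f z * indicator Delta z \<partial>lborel) =
    (\<integral>\<^sup>+x. (\<integral>\<^sup>+y. f (x, y) * indicator {0..1 - x} y \<partial>lborel) * indicator {0..1} x \<partial>lborel)"
proof -
  have ind: "indicator Delta (x, y) = (indicator {0..1 - x} y * indicator {0..1} x :: ennreal)" for x y
    by (auto simp: Delta_def indicator_def)
  have meas: "f \<in> borel_measurable (lborel \<Otimes>\<^sub>M lborel)"
    using assms by (simp add: lborel_prod)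
  have [measurable]: "Delta \<in> sets (lborel \<Otimes>\<^sub>M lborel)"
    by (simp only: lborel_prod sets_lborel Delta_measurable)
  have "(\<integral>\<^sup>+z. f z * indicator Delta z \<partial>lborel) =
     (\<integral>\<^sup>+z. f z * indicator Delta z \<partial>(lborel \<Otimes>\<^sub>M lborel))"
    by (simp add: lborel_prod)
  also have "\<dots> = (\<integral>\<^sup>+x. \<integral>\<^sup>+y. f (x, y) * indicator Delta (x, y) \<partial>lborel \<partial>lborel)"
    by (rule lborel.nn_integral_fst[symmetric]) (use meas in measurable)
  also have "\<dots> = (\<integral>\<^sup>+x. (\<integral>\<^sup>+y. f (x, y) * indicator {0..1 - x} y \<partial>lborel) * indicator {0..1} x \<partial>lborel)"
  proof (rule nn_integral_cong)
    fix x :: real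
    show "(\<integral>\<^sup>+y. f (x, y) * indicator Delta (x, y) \<partial>lborel) =
      (\<integral>\<^sup>+y. f (x, y) * indicator {0..1 - x} y \<partial>lborel) * indicator {0..1} x"
      by (cases "x \<in> {0..1}") (simp_all add: ind)
  qed
  finally show ?thesis .
qed

text \<open>At the left endpoint the antiderivative is only continuous, with v^(m+1) ln v \<rightarrow> 0; since ln 0 = 0,
its limit there is its value.\<close>
lemma ln_moment:
  "((\<lambda>v. - ln v * v ^ m) has_integral 1 / real (m + 1) ^ 2) {0..1}"
proof -
  define A :: "real \<Rightarrow> real"
    where "A v = v ^ (m + 1) * (1 / real (m + 1) ^ 2 - ln v / real (m + 1))" for v
  have "(A \<longlongrightarrow> 0) (at_right 0)"
    unfolding A_def by real_asymp
  then have at0: "(A \<longlongrightarrow> A 0) (at 0 within {0..1})"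
    by (metis (no_types, lifting) A_def add_is_0 at_within_Icc_at_right less_numeral_extra(1) mult_zero_left one_neq_zero power_0_left)
  have "continuous_on {0..1} A"
    unfolding continuous_on_def
  proof
    fix x :: real assume x: "x \<in> {0..1}"
    show "(A \<longlongrightarrow> A x) (at x within {0..1})"
    proof (cases "x = 0")
      case False
      with x show ?thesis unfolding A_def by (auto intro!: tendsto_eq_intros)
    qed (use at0 in simp)
  qed
  moreover have "(A has_vector_derivative - ln x * x ^ m) (at x)" if "x \<in> {0<..<1}" for x
  proof -
    have power: "((\<lambda>v. v ^ (m + 1)) has_real_derivative real (m + 1) * x ^ m) (at x)"
      using DERIV_pow[of "m + 1" x] by simp
    have x: "x > 0" using that by simp
    define c where "c = real (m + 1)"
    have c: "c \<noteq> 0" by (simp add: c_def)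
    have "((\<lambda>v. 1 / c\<^sup>2 - ln v / c) has_real_derivative - (1 / x / c)) (at x)"
      using x c by (auto intro!: derivative_eq_intros)
    then have "((\<lambda>v. v ^ (m + 1) * (1 / c\<^sup>2 - ln v / c)) has_real_derivative
       c * x ^ m * (1 / c\<^sup>2 - ln x / c) + - (1 / x / c) * x ^ (m + 1)) (at x)"
      using DERIV_mult[OF power] by (simp only: c_def)
    also have "c * x ^ m * (1 / c\<^sup>2 - ln x / c) + - (1 / x / c) * x ^ (m + 1) = - ln x * x ^ m"
      using x c by (simp add: power2_eq_square right_diff_distrib)
    finally have "(A has_real_derivative - ln x * x ^ m) (at x)"
      by (simp only: A_def[abs_def] c_def)
    then show ?thesis by (simp add: has_real_derivative_iff_has_vector_derivative)
  qed
  ultimately have "((\<lambda>v. - ln v * v ^ m) has_integral (A 1 - A 0)) {0..1}"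
    by (intro fundamental_theorem_of_calculus_interior) auto
  then show ?thesis by (simp add: A_def)
qed

text \<open>Expand 1/(1 + v^2) as a geometric series and integrate termwise. The partial sums are dominated by
-2 ln v, and at both endpoints every term is 0 because ln 0 = ln 1 = 0.\<close>
lemma Catalan_G_log_integral:
  "((\<lambda>v. - ln v / (1 + v\<^sup>2)) has_integral Catalan_G) {0..1}"
proof -
  define f :: "nat \<Rightarrow> real \<Rightarrow> real"
    where "f n v = (\<Sum>k<n. (-1) ^ k * (- ln v * v ^ (2 * k)))" for n v
  have int: "(f n has_integral (\<Sum>k<n. (-1) ^ k * (1 / real (2 * k + 1) ^ 2))) {0..1}" for n
    unfolding f_def by (intro has_integral_sum has_integral_mult_right ln_moment) auto
  have closed: "f n v = - ln v / (1 + v\<^sup>2) * (1 - (- (v\<^sup>2)) ^ n)" for n v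
  proof -
    have "f n v = - ln v * (\<Sum>k<n. (- (v\<^sup>2)) ^ k)"
      unfolding f_def sum_distrib_left
    proof (rule sum.cong)
      fix k show "(-1) ^ k * (- ln v * v ^ (2 * k)) = - ln v * (- (v\<^sup>2)) ^ k"
        by (subst power_minus) (simp add: power_mult)
    qed simp
    also have "(\<Sum>k<n. (- (v\<^sup>2)) ^ k) = (1 - (- (v\<^sup>2)) ^ n) / (1 + v\<^sup>2)"
      using sum_gp_strict[of "- (v\<^sup>2)" n] by (smt (verit) zero_le_power2)
    finally show ?thesis by simp
  qed
  have dom: "norm (f n v) \<le> 2 * (- ln v * v ^ 0)" if "v \<in> {0..1}" for n v
  proof (cases "v = 0")
    case False
    with that have v: "0 < v" "v \<le> 1" by auto
    have "\<bar>(- (v\<^sup>2)) ^ n\<bar> \<le> 1"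
      using v by (simp add: power_abs power_le_one)
    then have "\<bar>1 - (- (v\<^sup>2)) ^ n\<bar> \<le> 2" by linarith
    moreover have "- ln v / (1 + v\<^sup>2) \<le> - ln v / 1"
      using v by (intro divide_left_mono) (auto intro: add_pos_nonneg)
    then have "\<bar>- ln v / (1 + v\<^sup>2)\<bar> \<le> - ln v"
      using v by (simp add: abs_of_nonpos divide_nonpos_nonneg)
    ultimately have "\<bar>- ln v / (1 + v\<^sup>2)\<bar> * \<bar>1 - (- (v\<^sup>2)) ^ n\<bar> \<le> - ln v * 2"
      using v by (intro mult_mono) auto
    then show ?thesis unfolding closed real_norm_def abs_mult by simp
  qed (simp add: closed)
  have lim: "(\<lambda>n. f n v) \<longlonglongrightarrow> - ln v / (1 + v\<^sup>2)" if "v \<in> {0..1}" for v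
  proof (cases "v = 0 \<or> v = 1")
    case False
    with that have "\<bar>- (v\<^sup>2)\<bar> < 1" by (simp add: abs_square_less_1)
    then have "(\<lambda>n. (- (v\<^sup>2)) ^ n) \<longlonglongrightarrow> 0" by (intro LIMSEQ_power_zero) simp
    then have "(\<lambda>n. - ln v / (1 + v\<^sup>2) * (1 - (- (v\<^sup>2)) ^ n)) \<longlonglongrightarrow> - ln v / (1 + v\<^sup>2) * (1 - 0)"
      by (intro tendsto_mult tendsto_diff tendsto_const)
    then show ?thesis by (simp add: closed)
  qed (auto simp: closed)
  have "(\<lambda>v. 2 * (- ln v * v ^ 0)) integrable_on {0..1::real}"
    using has_integral_mult_right[OF ln_moment[of 0], of 2] by blast
  note dc = dominated_convergence[of f, OF has_integral_integrable[OF int] this dom lim]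
  have "(\<lambda>n. \<Sum>k<n. (-1) ^ k * (1 / real (2 * k + 1) ^ 2)) \<longlonglongrightarrow>
    integral {0..1} (\<lambda>v. - ln v / (1 + v\<^sup>2))"
    using dc(2) by (simp add: integral_unique[OF int])
  then have "(\<lambda>k. (-1) ^ k / real (2 * k + 1) ^ 2) sums integral {0..1} (\<lambda>v. - ln v / (1 + v\<^sup>2))"
    by (simp add: sums_def)
  then have "Catalan_G = integral {0..1} (\<lambda>v. - ln v / (1 + v\<^sup>2))"
    unfolding Catalan_G_def by (simp add: sums_iff)
  with dc(1) show ?thesis by (metis integrable_integral)
qed

text \<open>With x = 2v/(1 + v^2) the number 1 - x^2 is the square of c = (1 - v^2)/(1 + v^2), so the inner
integral is elementary with a rational argument of the logarithm: (c + (1 - x))/(c - (1 - x)) = 1/v.\<close>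
lemma inner_kernel_integral:
  fixes v y :: real
  assumes "0 < v" "v < 1"
  defines "x \<equiv> 2 * v / (1 + v\<^sup>2)" and "c \<equiv> (1 - v\<^sup>2) / (1 + v\<^sup>2)"
  shows "((\<lambda>y. 1 / (1 - x\<^sup>2 - y\<^sup>2)) has_integral (- ln v / (2 * c))) {0..1 - x}"
    and "0 \<le> y \<Longrightarrow> y \<le> 1 - x \<Longrightarrow> 0 < 1 - x\<^sup>2 - y\<^sup>2"
proof -
  have pos: "1 + v\<^sup>2 > 0" by (simp add: add_pos_nonneg)
  have v2: "v\<^sup>2 < 1" using assms(1,2) by (simp add: power_less_one_iff)
  have c: "c > 0" using v2 pos by (simp add: c_def)
  have c2: "1 - x\<^sup>2 = c\<^sup>2"
    using pos unfolding x_def c_def by (simp add: divide_simps) (simp add: power2_eq_square algebra_simps)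
  have one_minus_x: "1 - x = (1 - v)\<^sup>2 / (1 + v\<^sup>2)"
    using pos unfolding x_def by (simp add: divide_simps) (simp add: power2_eq_square algebra_simps)
  have sum: "c + (1 - x) = 2 * (1 - v) / (1 + v\<^sup>2)"
    unfolding one_minus_x c_def by (simp add: power2_eq_square algebra_simps flip: add_divide_distrib)
  have diff: "c - (1 - x) = 2 * v * (1 - v) / (1 + v\<^sup>2)"
    unfolding one_minus_x c_def by (simp add: power2_eq_square algebra_simps flip: diff_divide_distrib)
  have "c - (1 - x) > 0"
    unfolding diff using assms(1,2) pos by simp
  then have less: "y < c" if "y \<le> 1 - x" for y using that by simp
  have x1: "0 \<le> 1 - x" using pos by (simp add: one_minus_x)
  have "((\<lambda>y. 1 / (1 - x\<^sup>2 - y\<^sup>2)) has_integral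
    ((ln (c + (1 - x)) - ln (c - (1 - x))) / (2 * c) - (ln (c + 0) - ln (c - 0)) / (2 * c))) {0..1 - x}"
  proof (intro fundamental_theorem_of_calculus x1)
    fix y assume "y \<in> {0..1 - x}"
    then have y: "0 \<le> y" "y < c" using less by auto
    then have "c + y > 0" "c - y > 0" using c by auto
    then have "((\<lambda>y. ln (c + y) - ln (c - y)) has_real_derivative 1 / (c + y) + 1 / (c - y))
       (at y within {0..1 - x})"
      by (auto intro!: derivative_eq_intros)
    then have "((\<lambda>y. (ln (c + y) - ln (c - y)) / (2 * c)) has_real_derivative
       (1 / (c + y) + 1 / (c - y)) / (2 * c)) (at y within {0..1 - x})"
      by (rule DERIV_cdivide)
    also have "(1 / (c + y) + 1 / (c - y)) / (2 * c) = 1 / ((c + y) * (c - y))"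
    proof -
      have "(1 / p + 1 / q) / (p + q) = 1 / (p * q)" if "p > 0" "q > 0" for p q :: real
        using that by (simp add: divide_simps)
      from this[OF \<open>c + y > 0\<close> \<open>c - y > 0\<close>] show ?thesis by simp
    qed
    also have "(c + y) * (c - y) = 1 - x\<^sup>2 - y\<^sup>2"
      unfolding c2 by (simp add: power2_eq_square algebra_simps)
    finally show "((\<lambda>y. (ln (c + y) - ln (c - y)) / (2 * c)) has_vector_derivative
       1 / (1 - x\<^sup>2 - y\<^sup>2)) (at y within {0..1 - x})"
      by (simp add: has_real_derivative_iff_has_vector_derivative)
  qed
  moreover have "ln (c + (1 - x)) - ln (c - (1 - x)) = - ln v"
  proof -
    have "c - (1 - x) = v * (c + (1 - x))" unfolding sum diff by simp
    moreover have "c + (1 - x) > 0" using c x1 by simp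
    ultimately show ?thesis using assms(1) by (simp add: ln_mult)
  qed
  ultimately show "((\<lambda>y. 1 / (1 - x\<^sup>2 - y\<^sup>2)) has_integral (- ln v / (2 * c))) {0..1 - x}"
    by simp
  show "0 < 1 - x\<^sup>2 - y\<^sup>2" if "0 \<le> y" "y \<le> 1 - x"
    unfolding c2 using less[OF that(2)] that(1) c by (simp add: power_strict_mono)
qed

definition circle_kernel :: "real \<times> real \<Rightarrow> real" where
  "circle_kernel z = 1 / (1 - (fst z)\<^sup>2 - (snd z)\<^sup>2)"

lemma circle_kernel_measurable [measurable]: "circle_kernel \<in> borel_measurable borel"
  unfolding circle_kernel_def borel_prod[symmetric] by measurable

lemma log_integrand_nonneg:
  fixes v :: real
  assumes "v \<in> {0..1}"
  shows "0 \<le> - ln v / (1 + v\<^sup>2)"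
proof (cases "v = 0")
  case False
  with assms have "ln v \<le> 0" by simp
  then show ?thesis by (simp add: divide_nonpos_nonneg)
qed simp

text \<open>The substitution x = 2v/(1 + v^2) maps (0,1) onto itself and turns the iterated integral into that
of -ln v/(1 + v^2).\<close>
lemma nn_integral_circle_kernel:
  "(\<integral>\<^sup>+z. ennreal (circle_kernel z) * indicator Delta z \<partial>lborel) = ennreal Catalan_G"
proof -
  define f :: "real \<Rightarrow> ennreal"
    where "f x = (\<integral>\<^sup>+y. ennreal (1 / (1 - x\<^sup>2 - y\<^sup>2)) * indicator {0..1 - x} y \<partial>lborel)" for x
  define g :: "real \<Rightarrow> real" where "g v = 2 * v / (1 + v\<^sup>2)" for v
  define g' :: "real \<Rightarrow> real" where "g' v = 2 * (1 - v\<^sup>2) / (1 + v\<^sup>2)\<^sup>2" for v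
  have pos: "1 + v\<^sup>2 > 0" for v :: real by (simp add: add_pos_nonneg)
  have nz: "1 + v\<^sup>2 \<noteq> 0" for v :: real using pos[of v] by simp
  have kernel_ennreal: "(\<lambda>z. ennreal (circle_kernel z)) \<in> borel_measurable borel"
    by measurable
  have "(\<integral>\<^sup>+z. ennreal (circle_kernel z) * indicator Delta z \<partial>lborel) =
    (\<integral>\<^sup>+x. f x * indicator {0..1} x \<partial>lborel)"
    unfolding nn_integral_Delta[OF kernel_ennreal] f_def by (simp add: circle_kernel_def)
  also have "\<dots> = (\<integral>\<^sup>+x. f x * indicator {g 0..g 1} x \<partial>lborel)"
    by (simp add: g_def)
  also have "\<dots> = (\<integral>\<^sup>+v. f (g v) * ennreal (g' v) * indicator {0..1} v \<partial>lborel)"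
  proof (rule nn_integral_substitution_aux)
    have "(\<lambda>(x, y). ennreal (1 / (1 - x\<^sup>2 - y\<^sup>2)) * indicator {z. 0 \<le> snd z \<and> snd z \<le> 1 - fst z} (x, y))
      \<in> borel_measurable (borel \<Otimes>\<^sub>M lborel)"
      by measurable
    then have "(\<lambda>x. \<integral>\<^sup>+y. (case (x, y) of (x, y) \<Rightarrow>
       ennreal (1 / (1 - x\<^sup>2 - y\<^sup>2)) * indicator {z. 0 \<le> snd z \<and> snd z \<le> 1 - fst z} (x, y)) \<partial>lborel)
      \<in> borel_measurable borel"
      by (rule lborel.borel_measurable_nn_integral_fst)
    then show "f \<in> borel_measurable borel"
      by (simp add: f_def [abs_def] indicator_def)
    show "(g has_real_derivative g' v) (at v)" for v
      unfolding g_def g'_def using nz[of v]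
      by (auto intro!: derivative_eq_intros simp: power2_eq_square field_simps)
    show "continuous_on {0..1} g'"
      unfolding g'_def using nz by (intro continuous_intros) auto
    show "0 \<le> g' v" if "v \<in> {0..1}" for v
      unfolding g'_def using that by (auto intro!: divide_nonneg_nonneg simp: power_le_one)
  qed auto
  also have "\<dots> = (\<integral>\<^sup>+v. ennreal (- ln v / (1 + v\<^sup>2)) * indicator {0..1} v \<partial>lborel)"
  proof (rule nn_integral_cong_AE)
    \<comment> \<open>At v = 0 the inner integral diverges, so the endpoints have to be discarded.\<close>
    have "AE v in lborel. v \<noteq> (0::real) \<and> v \<noteq> 1"
      by (auto simp: AE_lborel_singleton)
    then show "AE v in lborel. f (g v) * ennreal (g' v) * indicator {0..1} v =
       ennreal (- ln v / (1 + v\<^sup>2)) * indicator {0..1} v"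
    proof (rule AE_mp, intro AE_I2 impI)
      fix v :: real assume v: "v \<noteq> 0 \<and> v \<noteq> 1"
      show "f (g v) * ennreal (g' v) * indicator {0..1} v =
         ennreal (- ln v / (1 + v\<^sup>2)) * indicator {0..1} v"
      proof (cases "v \<in> {0..1}")
        case True
        with v have v01: "0 < v" "v < 1" by auto
        then have v2: "v\<^sup>2 < 1" by (simp add: power_less_one_iff)
        define c where "c = (1 - v\<^sup>2) / (1 + v\<^sup>2)"
        have "f (g v) = ennreal (- ln v / (2 * c))"
          unfolding f_def g_def c_def
          by (rule nn_integral_has_integral_lebesgue'[OF _ inner_kernel_integral(1)[OF v01]])
             (use inner_kernel_integral(2)[OF v01] in \<open>auto simp: less_imp_le\<close>)
        moreover have "- ln v / (2 * c) * g' v = - ln v / (1 + v\<^sup>2)"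
        proof -
          have "- l / (2 * (a / b)) * (2 * a / b\<^sup>2) = - l / b" if "a \<noteq> 0" "b \<noteq> 0" for a b l :: real
            using that by (simp add: power2_eq_square)
          from this[of "1 - v\<^sup>2" "1 + v\<^sup>2"] show ?thesis
            unfolding c_def g'_def using v2 nz[of v] by simp
        qed
        moreover have "g' v \<ge> 0" using v2 by (simp add: g'_def)
        ultimately have "f (g v) * ennreal (g' v) = ennreal (- ln v / (1 + v\<^sup>2))"
          by (metis ennreal_mult'')
        then show ?thesis by simp
      qed simp
    qed
  qed
  also have "\<dots> = ennreal Catalan_G"
    by (rule nn_integral_has_integral_lebesgue'[OF log_integrand_nonneg Catalan_G_log_integral])
  finally show ?thesis .
qed

text \<open>The unit circle touches the triangle only at the two vertices where the weight is singular.\<close>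
lemma Delta_cases:
  assumes "z \<in> Delta"
  shows "(fst z)\<^sup>2 + (snd z)\<^sup>2 < 1 \<or> z = (1, 0) \<or> z = (0, 1)"
proof -
  obtain x y where z: "z = (x, y)" by force
  have xy: "0 \<le> x" "0 \<le> y" "x + y \<le> 1" using assms by (auto simp: z Delta_def)
  have "x\<^sup>2 \<le> x" "y\<^sup>2 \<le> y"
    using xy by (simp_all add: power2_eq_square mult_left_le_one_le)
  moreover have "x\<^sup>2 < x" if "0 < x" "x < 1" using that by (simp add: power2_eq_square)
  moreover have "y\<^sup>2 < y" if "0 < y" "y < 1" using that by (simp add: power2_eq_square)
  ultimately show ?thesis using xy unfolding z by (cases "x = 0"; cases "x = 1"; force)
qed

lemma circle_kernel_nonneg: "z \<in> Delta \<Longrightarrow> circle_kernel z \<ge> 0"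
  using Delta_cases[of z] by (auto simp: circle_kernel_def)

lemma
  shows circle_kernel_integrable: "set_integrable lborel Delta circle_kernel"
    and integral_circle_kernel: "(LINT z:Delta|lborel. circle_kernel z) = Catalan_G"
proof -
  have *: "(\<integral>\<^sup>+z. ennreal (indicator Delta z * circle_kernel z) \<partial>lborel) = ennreal Catalan_G"
    unfolding nn_integral_circle_kernel[symmetric]
    by (intro nn_integral_cong) (auto simp: indicator_def)
  have nonneg: "AE z in lborel. 0 \<le> indicator Delta z * circle_kernel z"
    using circle_kernel_nonneg by (auto simp: indicator_def)
  have "Catalan_G \<ge> 0"
    by (rule has_integral_nonneg[OF Catalan_G_log_integral]) (rule log_integrand_nonneg)
  have meas: "(\<lambda>z. indicator Delta z * circle_kernel z) \<in> borel_measurable lborel" by measurable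
  show "set_integrable lborel Delta circle_kernel"
    unfolding set_integrable_def real_scaleR_def
    by (rule integrableI_nonneg[OF meas nonneg]) (simp add: *)
  show "(LINT z:Delta|lborel. circle_kernel z) = Catalan_G"
    unfolding set_lebesgue_integral_def
    using integral_eq_nn_integral[OF meas nonneg] * \<open>Catalan_G \<ge> 0\<close> by simp
qed

lemma weighted_integrable:
  assumes "continuous_on UNIV f"
  shows "set_integrable lborel Delta (\<lambda>z. f z * circle_kernel z)"
proof -
  have "bounded (f ` Delta)"
    by (intro compact_imp_bounded compact_continuous_image compact_Delta continuous_on_subset[OF assms]) auto
  then obtain B where B: "\<And>z. z \<in> Delta \<Longrightarrow> \<bar>f z\<bar> \<le> B"
    by (auto simp: bounded_iff)
  have [measurable]: "f \<in> borel_measurable borel"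
    using assms by (rule borel_measurable_continuous_onI)
  have "integrable lborel (\<lambda>z. B * (indicator Delta z *\<^sub>R circle_kernel z))"
    using circle_kernel_integrable unfolding set_integrable_def by (rule integrable_mult_right)
  then show ?thesis
    unfolding set_integrable_def
  proof (rule Bochner_Integration.integrable_bound)
    show "AE z in lborel. norm (indicator Delta z *\<^sub>R (f z * circle_kernel z)) \<le>
      norm (B * (indicator Delta z *\<^sub>R circle_kernel z))"
    proof (intro AE_I2)
      fix z
      have "\<bar>f z\<bar> * \<bar>circle_kernel z\<bar> \<le> \<bar>B\<bar> * \<bar>circle_kernel z\<bar>" if "z \<in> Delta"
        using B[OF that] by (intro mult_right_mono) auto
      then show "norm (indicator Delta z *\<^sub>R (f z * circle_kernel z)) \<le>
         norm (B * (indicator Delta z *\<^sub>R circle_kernel z))"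
        by (auto simp: indicator_def abs_mult)
    qed
  qed measurable
qed

lemma continuous_integrable:
  assumes "continuous_on UNIV f"
  shows "set_integrable lborel Delta (f :: _ \<Rightarrow> real)"
  unfolding set_integrable_def
  by (intro borel_integrable_compact compact_Delta continuous_on_subset[OF assms]) auto

section \<open>Plain and weighted integrals over the triangle\<close>

definition Delta_integral :: "(real \<times> real \<Rightarrow> real) \<Rightarrow> real" where
  "Delta_integral f = (LINT z:Delta|lborel. f z)"

definition weighted_integral :: "(real \<times> real \<Rightarrow> real) \<Rightarrow> real" where
  "weighted_integral f = (LINT z:Delta|lborel. f z * circle_kernel z)"

lemma Delta_integral_add:
  "continuous_on UNIV f \<Longrightarrow> continuous_on UNIV g \<Longrightarrow>
    Delta_integral (\<lambda>z. f z + g z) = Delta_integral f + Delta_integral g"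
  unfolding Delta_integral_def by (intro set_integral_add continuous_integrable)

lemma Delta_integral_diff:
  "continuous_on UNIV f \<Longrightarrow> continuous_on UNIV g \<Longrightarrow>
    Delta_integral (\<lambda>z. f z - g z) = Delta_integral f - Delta_integral g"
  unfolding Delta_integral_def by (intro set_integral_diff continuous_integrable)

lemma Delta_integral_mult: "Delta_integral (\<lambda>z. c * f z) = c * Delta_integral f"
  unfolding Delta_integral_def by simp

lemma Delta_integral_sum:
  assumes "finite A" "\<And>i. i \<in> A \<Longrightarrow> continuous_on UNIV (f i)"
  shows "Delta_integral (\<lambda>z. \<Sum>i\<in>A. f i z) = (\<Sum>i\<in>A. Delta_integral (f i))"
  using assms
proof (induction A rule: finite_induct)
  case empty
  then show ?case by (simp add: Delta_integral_def set_lebesgue_integral_def)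
qed (simp add: Delta_integral_add continuous_on_sum)

lemma weighted_integral_add:
  "continuous_on UNIV f \<Longrightarrow> continuous_on UNIV g \<Longrightarrow>
    weighted_integral (\<lambda>z. f z + g z) = weighted_integral f + weighted_integral g"
  unfolding weighted_integral_def distrib_right by (intro set_integral_add weighted_integrable)

lemma weighted_integral_diff:
  "continuous_on UNIV f \<Longrightarrow> continuous_on UNIV g \<Longrightarrow>
    weighted_integral (\<lambda>z. f z - g z) = weighted_integral f - weighted_integral g"
  unfolding weighted_integral_def left_diff_distrib by (intro set_integral_diff weighted_integrable)

lemma weighted_integral_mult: "weighted_integral (\<lambda>z. c * f z) = c * weighted_integral f"
  unfolding weighted_integral_def mult.assoc by simp

lemma weighted_integral_sum:
  assumes "finite A" "\<And>i. i \<in> A \<Longrightarrow> continuous_on UNIV (f i)"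
  shows "weighted_integral (\<lambda>z. \<Sum>i\<in>A. f i z) = (\<Sum>i\<in>A. weighted_integral (f i))"
  using assms
proof (induction A rule: finite_induct)
  case empty
  then show ?case by (simp add: weighted_integral_def set_lebesgue_integral_def)
qed (simp add: weighted_integral_add continuous_on_sum)

lemma weighted_integral_1: "weighted_integral (\<lambda>z. 1) = Catalan_G"
  by (simp add: weighted_integral_def integral_circle_kernel)

lemma AE_inside_circle: "AE z in lborel. z \<in> Delta \<longrightarrow> (fst z)\<^sup>2 + (snd z)\<^sup>2 < 1"
proof -
  have "AE z in lborel. z \<noteq> ((1, 0) :: real \<times> real)" "AE z in lborel. z \<noteq> ((0, 1) :: real \<times> real)"
    by (rule AE_lborel_singleton)+
  then show ?thesis
    by eventually_elim (use Delta_cases in blast)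
qed

text \<open>This is the integral of f (1 - \<rho>)/(1 - \<rho>), where the quotient is 1 almost everywhere on the triangle.\<close>
lemma weighted_integral_radius:
  assumes "continuous_on UNIV f"
  shows "weighted_integral (\<lambda>z. f z * ((fst z)\<^sup>2 + (snd z)\<^sup>2)) =
    weighted_integral f - Delta_integral f"
proof -
  have "weighted_integral f - weighted_integral (\<lambda>z. f z * ((fst z)\<^sup>2 + (snd z)\<^sup>2)) =
    weighted_integral (\<lambda>z. f z - f z * ((fst z)\<^sup>2 + (snd z)\<^sup>2))"
    by (intro weighted_integral_diff[symmetric] continuous_intros assms)
  also have "\<dots> = Delta_integral f"
    unfolding weighted_integral_def Delta_integral_def
  proof (rule set_lebesgue_integral_cong_AE)
    have [measurable]: "f \<in> borel_measurable borel"
      using assms by (rule borel_measurable_continuous_onI)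
    have [measurable]: "(\<lambda>z. (fst z)\<^sup>2 + (snd z)\<^sup>2 :: real) \<in> borel_measurable borel"
      by (intro borel_measurable_continuous_onI continuous_intros)
    show "(\<lambda>z. (f z - f z * ((fst z)\<^sup>2 + (snd z)\<^sup>2)) * circle_kernel z) \<in> borel_measurable lborel"
      by measurable
    show "f \<in> borel_measurable lborel" by measurable
    have cancel: "(f z - f z * ((fst z)\<^sup>2 + (snd z)\<^sup>2)) * circle_kernel z = f z"
      if "(fst z)\<^sup>2 + (snd z)\<^sup>2 < 1" for z
    proof -
      have "f z - f z * ((fst z)\<^sup>2 + (snd z)\<^sup>2) = f z * (1 - (fst z)\<^sup>2 - (snd z)\<^sup>2)"
        by (simp add: algebra_simps)
      then show ?thesis using that by (simp add: circle_kernel_def)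
    qed
    show "AE z in lborel. z \<in> Delta \<longrightarrow>
        (f z - f z * ((fst z)\<^sup>2 + (snd z)\<^sup>2)) * circle_kernel z = f z"
      using AE_inside_circle by eventually_elim (use cancel in blast)
  qed simp
  finally show ?thesis by simp
qed

lemma Delta_integral_monomial:
  "Delta_integral (\<lambda>z. fst z ^ i * snd z ^ j) = beta_nat i j / real (i + j + 2)"
proof -
  let ?f = "\<lambda>z :: real \<times> real. fst z ^ i * snd z ^ j"
  have meas: "?f \<in> borel_measurable borel"
    by (intro borel_measurable_continuous_onI continuous_intros)
  then have emeas: "(\<lambda>z. ennreal (?f z)) \<in> borel_measurable borel" by measurable
  have inner: "(\<integral>\<^sup>+y. ennreal (x ^ i * y ^ j) * indicator {0..1 - x} y \<partial>lborel) =
    ennreal (x ^ i * (1 - x) ^ Suc j / real (Suc j))" if "x \<in> {0..1}" for x :: real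
  proof (rule nn_integral_has_integral_lebesgue')
    have "((\<lambda>y. x ^ i * y ^ j) has_integral
      (x ^ i * (1 - x) ^ Suc j / real (Suc j) - x ^ i * 0 ^ Suc j / real (Suc j))) {0..1 - x}"
    proof (rule fundamental_theorem_of_calculus)
      fix y :: real
      have "((\<lambda>y. y ^ Suc j) has_real_derivative real (Suc j) * y ^ j) (at y within {0..1 - x})"
        using DERIV_pow[of "Suc j" y] by (simp add: has_field_derivative_at_within)
      from DERIV_cmult[OF this, of "x ^ i / real (Suc j)"]
      show "((\<lambda>y. x ^ i * y ^ Suc j / real (Suc j)) has_vector_derivative x ^ i * y ^ j)
         (at y within {0..1 - x})"
        by (simp add: has_real_derivative_iff_has_vector_derivative)
    qed (use that in simp)
    then show "((\<lambda>y. x ^ i * y ^ j) has_integral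
      (x ^ i * (1 - x) ^ Suc j / real (Suc j))) {0..1 - x}" by simp
  qed (use that in simp)
  have "(\<integral>\<^sup>+z. ennreal (?f z) * indicator Delta z \<partial>lborel) =
    (\<integral>\<^sup>+x. ennreal (x ^ i * (1 - x) ^ Suc j / real (Suc j)) * indicator {0..1} x \<partial>lborel)"
    unfolding nn_integral_Delta[OF emeas]
  proof (rule nn_integral_cong)
    fix x :: real
    show "(\<integral>\<^sup>+y. ennreal (?f (x, y)) * indicator {0..1 - x} y \<partial>lborel) * indicator {0..1} x =
      ennreal (x ^ i * (1 - x) ^ Suc j / real (Suc j)) * indicator {0..1} x"
    proof (cases "x \<in> {0..1}")
      case True
      then show ?thesis using inner[OF True] by (simp del: of_nat_Suc)
    qed simp
  qed
  also have "\<dots> = ennreal (beta_nat i (Suc j) / real (Suc j))"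
    by (rule nn_integral_has_integral_lebesgue')
       (auto intro!: has_integral_divide has_integral_beta_nat divide_nonneg_nonneg
          simp del: power_Suc of_nat_Suc)
  also have "(\<integral>\<^sup>+z. ennreal (?f z) * indicator Delta z \<partial>lborel) =
      (\<integral>\<^sup>+z. ennreal (indicator Delta z * ?f z) \<partial>lborel)"
    by (intro nn_integral_cong) (simp add: indicator_def)
  finally have nn: "(\<integral>\<^sup>+z. ennreal (indicator Delta z * ?f z) \<partial>lborel) =
     ennreal (beta_nat i (Suc j) / real (Suc j))" .
  have "Delta_integral ?f = enn2real (\<integral>\<^sup>+z. ennreal (indicator Delta z * ?f z) \<partial>lborel)"
    unfolding Delta_integral_def set_lebesgue_integral_def real_scaleR_def
  proof (rule integral_eq_nn_integral)
    show "(\<lambda>z. indicator Delta z * ?f z) \<in> borel_measurable lborel"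
      using meas by measurable
    show "AE z in lborel. 0 \<le> indicator Delta z * ?f z"
      by (auto simp: indicator_def Delta_eq)
  qed
  also have "\<dots> = beta_nat i (Suc j) / real (Suc j)"
    unfolding nn by (simp add: beta_nat_def)
  also have "\<dots> = beta_nat i j / real (i + j + 2)"
    by (simp add: beta_nat_def divide_simps)
  finally show ?thesis .
qed

section \<open>Integrating along the rotation field\<close>

text \<open>The derivative of x^(a+1) y^(b+1) along the rotation field x \<partial>/\<partial>y - y \<partial>/\<partial>x. The exponents are
shifted because the relation below needs the differentiated monomial to be divisible by xy.\<close>
definition rot_monomial :: "nat \<Rightarrow> nat \<Rightarrow> real \<times> real \<Rightarrow> real" where
  "rot_monomial a b z =
    real (Suc b) * (fst z ^ (a + 2) * snd z ^ b) - real (Suc a) * (fst z ^ a * snd z ^ (b + 2))"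

lemma continuous_rot_monomial [continuous_intros]: "continuous_on A (rot_monomial a b)"
  unfolding rot_monomial_def by (intro continuous_intros)

text \<open>Stokes' theorem for the rotation field applied to x^(a+1) y^(b+1) \<rho>^m: the field is tangent to the
circles \<rho> = const, hence does not differentiate \<rho>, and the monomial vanishes on the legs, so only the
hypotenuse (t, 1 - t) contributes. For m = 0 both sides are Beta values. For the step, multiply the
monomial by \<rho> = x^2 + y^2 instead of raising m.\<close>
lemma rot_monomial_moment:
  "((\<lambda>t. (t - (1 - t)) * t ^ Suc a * (1 - t) ^ Suc b * (t\<^sup>2 + (1 - t)\<^sup>2) ^ m) has_integral
    Delta_integral (\<lambda>z. rot_monomial a b z * ((fst z)\<^sup>2 + (snd z)\<^sup>2) ^ m)) {0..1}"
proof (induction m arbitrary: a b)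
  case 0
  have "Delta_integral (rot_monomial a b) =
    real (Suc b) * Delta_integral (\<lambda>z. fst z ^ (a + 2) * snd z ^ b) -
    real (Suc a) * Delta_integral (\<lambda>z. fst z ^ a * snd z ^ (b + 2))"
    unfolding rot_monomial_def Delta_integral_mult[symmetric]
    by (intro Delta_integral_diff continuous_intros)
  also have "\<dots> = beta_nat (a + 2) (Suc b) - beta_nat (Suc a) (b + 2)"
    unfolding Delta_integral_monomial
    by (simp add: beta_nat_def add_ac divide_simps)
  finally have eq: "Delta_integral (rot_monomial a b) = beta_nat (a + 2) (Suc b) - beta_nat (Suc a) (b + 2)" .
  have "((\<lambda>t. t ^ (a + 2) * (1 - t) ^ Suc b - t ^ Suc a * (1 - t) ^ (b + 2)) has_integral
    Delta_integral (rot_monomial a b)) {0..1}"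
    unfolding eq by (intro has_integral_diff has_integral_beta_nat)
  then show ?case by (simp add: algebra_simps)
next
  case (Suc m)
  let ?r = "\<lambda>z :: real \<times> real. (fst z)\<^sup>2 + (snd z)\<^sup>2"
  have split: "rot_monomial a b z * ?r z ^ Suc m =
    rot_monomial (a + 2) b z * ?r z ^ m + rot_monomial a (b + 2) z * ?r z ^ m" for z
    by (simp add: rot_monomial_def power_add power2_eq_square algebra_simps)
  have "Delta_integral (\<lambda>z. rot_monomial a b z * ?r z ^ Suc m) =
    Delta_integral (\<lambda>z. rot_monomial (a + 2) b z * ?r z ^ m) +
    Delta_integral (\<lambda>z. rot_monomial a (b + 2) z * ?r z ^ m)"
    unfolding split by (intro Delta_integral_add continuous_intros)
  moreover have "(t - (1 - t)) * t ^ Suc a * (1 - t) ^ Suc b * (t\<^sup>2 + (1 - t)\<^sup>2) ^ Suc m =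
    (t - (1 - t)) * t ^ Suc (a + 2) * (1 - t) ^ Suc b * (t\<^sup>2 + (1 - t)\<^sup>2) ^ m +
    (t - (1 - t)) * t ^ Suc a * (1 - t) ^ Suc (b + 2) * (t\<^sup>2 + (1 - t)\<^sup>2) ^ m" for t :: real
  proof -
    have "u * A * B * W * (t\<^sup>2 + s\<^sup>2) = u * (t\<^sup>2 * A) * B * W + u * A * (s\<^sup>2 * B) * W"
      for u A B W s :: real by (simp add: algebra_simps)
    from this[of "t - (1 - t)" "t ^ Suc a" "(1 - t) ^ Suc b" "(t\<^sup>2 + (1 - t)\<^sup>2) ^ m" "1 - t"]
    show ?thesis by (simp add: power_add[symmetric] power2_eq_square mult_ac)
  qed
  ultimately show ?case
    using has_integral_add[OF Suc.IH[of "a + 2" b] Suc.IH[of a "b + 2"]] by simp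
qed

text \<open>The weight is the sum of the powers of \<rho>, and the partial sums are dominated by the weight itself.\<close>
lemma weighted_integral_as_limit:
  assumes "continuous_on UNIV f"
  shows "(\<lambda>n. Delta_integral (\<lambda>z. f z * (\<Sum>m<n. ((fst z)\<^sup>2 + (snd z)\<^sup>2) ^ m)))
    \<longlonglongrightarrow> weighted_integral f"
proof -
  let ?r = "\<lambda>z :: real \<times> real. (fst z)\<^sup>2 + (snd z)\<^sup>2"
  have [measurable]: "f \<in> borel_measurable borel"
    using assms by (rule borel_measurable_continuous_onI)
  have [measurable]: "?r \<in> borel_measurable borel"
    by (intro borel_measurable_continuous_onI continuous_intros)
  have gp: "(\<Sum>m<n. ?r z ^ m) = (1 - ?r z ^ n) * circle_kernel z" if "?r z < 1" for z n
    using that by (simp add: sum_gp_strict circle_kernel_def diff_diff_eq)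
  have "(\<lambda>n. LINT z|lborel. indicator Delta z *\<^sub>R (f z * (\<Sum>m<n. ?r z ^ m))) \<longlonglongrightarrow>
    (LINT z|lborel. indicator Delta z *\<^sub>R (f z * circle_kernel z))"
  proof (rule integral_dominated_convergence)
    show "integrable lborel (\<lambda>z. indicator Delta z *\<^sub>R (\<bar>f z\<bar> * circle_kernel z))"
      using weighted_integrable[of "\<lambda>z. \<bar>f z\<bar>"] assms
      by (simp add: set_integrable_def continuous_on_rabs)
    show "AE z in lborel. (\<lambda>n. indicator Delta z *\<^sub>R (f z * (\<Sum>m<n. ?r z ^ m))) \<longlonglongrightarrow>
      indicator Delta z *\<^sub>R (f z * circle_kernel z)"
      using AE_inside_circle
    proof eventually_elim
      case (elim z)
      show ?case
      proof (cases "z \<in> Delta")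
        case True
        with elim have r: "?r z < 1" by simp
        then have "(\<lambda>n. ?r z ^ n) \<longlonglongrightarrow> 0" by (intro LIMSEQ_power_zero) simp
        then have "(\<lambda>n. f z * ((1 - ?r z ^ n) * circle_kernel z)) \<longlonglongrightarrow>
          f z * ((1 - 0) * circle_kernel z)"
          by (intro tendsto_mult tendsto_diff tendsto_const)
        then show ?thesis using True by (simp add: gp[OF r])
      qed simp
    qed
    show "AE z in lborel. norm (indicator Delta z *\<^sub>R (f z * (\<Sum>m<n. ?r z ^ m)))
      \<le> indicator Delta z *\<^sub>R (\<bar>f z\<bar> * circle_kernel z)" for n
      using AE_inside_circle
    proof eventually_elim
      case (elim z)
      show ?case
      proof (cases "z \<in> Delta")
        case True
        with elim have r: "?r z < 1" by simp
        have "0 \<le> 1 - ?r z ^ n" "1 - ?r z ^ n \<le> 1"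
          using r by (auto simp: power_le_one)
        then have "\<bar>(1 - ?r z ^ n) * circle_kernel z\<bar> \<le> circle_kernel z"
          using circle_kernel_nonneg[OF True] by (simp add: abs_mult mult_left_le_one_le)
        then show ?thesis using True by (simp add: gp[OF r] abs_mult mult_left_mono)
      qed simp
    qed
  qed measurable
  then show ?thesis
    by (simp add: weighted_integral_def Delta_integral_def set_lebesgue_integral_def)
qed

text \<open>Sum the preceding relations over m. On the hypotenuse \<rho> = t^2 + (1 - t)^2 satisfies
1 - \<rho> = 2 t (1 - t), so the geometric series cancels one factor t and one factor 1 - t, and what is
left is integrable up to the vertices.\<close>
lemma weighted_integral_rot_monomial:
  "weighted_integral (rot_monomial a b) = (beta_nat (Suc a) b - beta_nat a (Suc b)) / 2"
proof -
  let ?r = "\<lambda>z :: real \<times> real. (fst z)\<^sup>2 + (snd z)\<^sup>2"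
  let ?w = "\<lambda>t :: real. t\<^sup>2 + (1 - t)\<^sup>2"
  let ?f = "\<lambda>n t. \<Sum>m<n. (t - (1 - t)) * t ^ Suc a * (1 - t) ^ Suc b * ?w t ^ m"
  have int: "(?f n has_integral Delta_integral (\<lambda>z. rot_monomial a b z * (\<Sum>m<n. ?r z ^ m)))
    {0<..<1}" for n
  proof -
    have "Delta_integral (\<lambda>z. rot_monomial a b z * (\<Sum>m<n. ?r z ^ m)) =
      (\<Sum>m<n. Delta_integral (\<lambda>z. rot_monomial a b z * ?r z ^ m))"
      unfolding sum_distrib_left by (intro Delta_integral_sum continuous_intros) auto
    moreover have "(?f n has_integral
      (\<Sum>m<n. Delta_integral (\<lambda>z. rot_monomial a b z * ?r z ^ m))) {0..1}"
      by (intro has_integral_sum rot_monomial_moment) auto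
    ultimately show ?thesis by (simp only: has_integral_Icc_iff_Ioo)
  qed
  have closed: "?f n t = (t - (1 - t)) * t ^ a * (1 - t) ^ b / 2 * (1 - ?w t ^ n)"
    and w: "0 \<le> ?w t" "?w t < 1" if "t \<in> {0<..<1}" for n t
  proof -
    have t: "0 < t" "t < 1" using that by auto
    have one_minus: "1 - ?w t = 2 * t * (1 - t)" by (simp add: power2_eq_square algebra_simps)
    have "t * (1 - t) > 0" using t by simp
    with one_minus show "?w t < 1" by linarith
    then have "(\<Sum>m<n. ?w t ^ m) = (1 - ?w t ^ n) / (2 * t * (1 - t))"
      using sum_gp_strict[of "?w t" n] unfolding one_minus by simp
    then show "?f n t = (t - (1 - t)) * t ^ a * (1 - t) ^ b / 2 * (1 - ?w t ^ n)"
    proof -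
      have "u * t ^ Suc a * s ^ Suc b * (X / (2 * t * s)) = u * t ^ a * s ^ b / 2 * X"
        if "s \<noteq> 0" for u s X :: real
        using t that by (simp add: divide_simps)
      from this[of "1 - t"] show ?thesis
        using t \<open>(\<Sum>m<n. ?w t ^ m) = _\<close> by (simp only: sum_distrib_left[symmetric])
    qed
  qed auto
  have "((\<lambda>t. (t - (1 - t)) * t ^ a * (1 - t) ^ b / 2) has_integral weighted_integral (rot_monomial a b))
    {0<..<1}"
  proof (rule has_integral_dominated_convergence[OF int])
    show "(\<lambda>t. 1 :: real) integrable_on {0<..<1::real}"
      using has_integral_beta_nat[of 0 0] by (auto simp: has_integral_Icc_iff_Ioo integrable_on_def)
    show "\<forall>t\<in>{0<..<1}. norm (?f n t) \<le> 1" for n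
    proof
      fix t :: real assume t: "t \<in> {0<..<1}"
      have "0 \<le> 1 - ?w t ^ n" "1 - ?w t ^ n \<le> 1"
        using w[OF t] by (auto simp: power_le_one)
      then have "\<bar>1 - ?w t ^ n\<bar> \<le> 1" by simp
      moreover have "\<bar>t - (1 - t)\<bar> \<le> 1" "\<bar>t ^ a\<bar> \<le> 1" "\<bar>(1 - t) ^ b\<bar> \<le> 1"
        using t by (auto simp: power_le_one)
      ultimately have "\<bar>t - (1 - t)\<bar> * \<bar>t ^ a\<bar> * \<bar>(1 - t) ^ b\<bar> / 2 * \<bar>1 - ?w t ^ n\<bar> \<le> 1 * 1 * 1 / 1 * 1"
        by (intro mult_mono frac_le) auto
      then show "norm (?f n t) \<le> 1"
        unfolding closed[OF t] by (simp only: real_norm_def abs_mult abs_divide)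
    qed
    show "\<forall>t\<in>{0<..<1}. (\<lambda>n. ?f n t) \<longlonglongrightarrow> (t - (1 - t)) * t ^ a * (1 - t) ^ b / 2"
    proof
      fix t :: real assume t: "t \<in> {0<..<1}"
      have "(\<lambda>n. ?w t ^ n) \<longlonglongrightarrow> 0" using w[OF t] by (intro LIMSEQ_power_zero) simp
      then have "(\<lambda>n. (t - (1 - t)) * t ^ a * (1 - t) ^ b / 2 * (1 - ?w t ^ n)) \<longlonglongrightarrow>
        (t - (1 - t)) * t ^ a * (1 - t) ^ b / 2 * (1 - 0)"
        by (intro tendsto_mult tendsto_diff tendsto_const)
      then show "(\<lambda>n. ?f n t) \<longlonglongrightarrow> (t - (1 - t)) * t ^ a * (1 - t) ^ b / 2"
        unfolding closed[OF t] by simp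
    qed
  qed (intro weighted_integral_as_limit continuous_intros)
  then have 1: "((\<lambda>t. (t - (1 - t)) * t ^ a * (1 - t) ^ b / 2) has_integral
    weighted_integral (rot_monomial a b)) {0..1}"
    by (simp only: has_integral_Icc_iff_Ioo)
  have "((\<lambda>t. (t ^ Suc a * (1 - t) ^ b - t ^ a * (1 - t) ^ Suc b) / 2) has_integral
    (beta_nat (Suc a) b - beta_nat a (Suc b)) / 2) {0..1}"
    by (intro has_integral_divide has_integral_diff has_integral_beta_nat)
  then have 2: "((\<lambda>t. (t - (1 - t)) * t ^ a * (1 - t) ^ b / 2) has_integral
    (beta_nat (Suc a) b - beta_nat a (Suc b)) / 2) {0..1}"
    by (simp add: algebra_simps)
  show ?thesis using has_integral_unique[OF 1 2] .
qed

section \<open>Combinations of 1 and Catalan's constant with bounded denominators\<close>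

definition catalan_lattice :: "nat \<Rightarrow> nat \<Rightarrow> real set" where
  "catalan_lattice u v = {\<alpha> + \<beta> * Catalan_G |\<alpha> \<beta>. real u * \<alpha> \<in> \<int> \<and> real v * \<beta> \<in> \<int>}"

lemma catalan_latticeI:
  "x = \<alpha> + \<beta> * Catalan_G \<Longrightarrow> real u * \<alpha> \<in> \<int> \<Longrightarrow> real v * \<beta> \<in> \<int> \<Longrightarrow> x \<in> catalan_lattice u v"
  unfolding catalan_lattice_def by blast

lemma catalan_latticeE:
  assumes "x \<in> catalan_lattice u v"
  obtains \<alpha> \<beta> where "x = \<alpha> + \<beta> * Catalan_G" "real u * \<alpha> \<in> \<int>" "real v * \<beta> \<in> \<int>"
  using assms unfolding catalan_lattice_def by blast

lemma catalan_lattice_rational: "real u * x \<in> \<int> \<Longrightarrow> x \<in> catalan_lattice u v"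
  by (rule catalan_latticeI[of x x 0]) auto

lemma catalan_lattice_add:
  assumes "x \<in> catalan_lattice u v" "y \<in> catalan_lattice u v"
  shows "x + y \<in> catalan_lattice u v"
proof -
  obtain \<alpha> \<beta> where x: "x = \<alpha> + \<beta> * Catalan_G" "real u * \<alpha> \<in> \<int>" "real v * \<beta> \<in> \<int>"
    using assms(1) by (rule catalan_latticeE)
  obtain \<gamma> \<delta> where y: "y = \<gamma> + \<delta> * Catalan_G" "real u * \<gamma> \<in> \<int>" "real v * \<delta> \<in> \<int>"
    using assms(2) by (rule catalan_latticeE)
  show ?thesis
    by (rule catalan_latticeI[of _ "\<alpha> + \<gamma>" "\<beta> + \<delta>"])
       (use x y in \<open>auto simp: distrib_left algebra_simps\<close>)
qed

lemma catalan_lattice_mult_Ints: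
  assumes "c \<in> \<int>" "x \<in> catalan_lattice u v"
  shows "c * x \<in> catalan_lattice u v"
proof -
  obtain \<alpha> \<beta> where x: "x = \<alpha> + \<beta> * Catalan_G" "real u * \<alpha> \<in> \<int>" "real v * \<beta> \<in> \<int>"
    using assms(2) by (rule catalan_latticeE)
  have "c * (real u * \<alpha>) \<in> \<int>" "c * (real v * \<beta>) \<in> \<int>" using assms(1) x by auto
  then show ?thesis
    by (intro catalan_latticeI[of _ "c * \<alpha>" "c * \<beta>"]) (auto simp: x(1) algebra_simps)
qed

lemma catalan_lattice_diff:
  "x \<in> catalan_lattice u v \<Longrightarrow> y \<in> catalan_lattice u v \<Longrightarrow> x - y \<in> catalan_lattice u v"
  using catalan_lattice_add[of x u v "- 1 * y"] catalan_lattice_mult_Ints[of "- 1" y u v] by simp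

lemma catalan_lattice_sum:
  "(\<And>i. i \<in> A \<Longrightarrow> f i \<in> catalan_lattice u v) \<Longrightarrow> sum f A \<in> catalan_lattice u v"
  by (induction A rule: infinite_finite_induct)
     (auto intro: catalan_lattice_add catalan_lattice_rational)

lemma catalan_lattice_mono:
  "x \<in> catalan_lattice u v \<Longrightarrow> u dvd u' \<Longrightarrow> v dvd v' \<Longrightarrow> x \<in> catalan_lattice u' v'"
  by (elim catalan_latticeE) (blast intro: catalan_latticeI Ints_of_nat_dvd_mult)

lemma catalan_lattice_divide:
  assumes "real m * x \<in> catalan_lattice u v" "m > 0"
  shows "x \<in> catalan_lattice (m * u) (m * v)"
proof -
  obtain \<alpha> \<beta> where x: "real m * x = \<alpha> + \<beta> * Catalan_G" "real u * \<alpha> \<in> \<int>" "real v * \<beta> \<in> \<int>"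
    using assms(1) by (rule catalan_latticeE)
  then have "x = \<alpha> / real m + \<beta> / real m * Catalan_G"
    using assms(2) by (simp add: field_simps)
  then show ?thesis
    by (rule catalan_latticeI) (use x assms(2) in auto)
qed

section \<open>Integrals of powers of x + iy\<close>

definition cz :: "real \<times> real \<Rightarrow> complex" where
  "cz z = Complex (fst z) (snd z)"

lemma cz_eq: "cz z = of_real (fst z) + \<i> * of_real (snd z)"
  by (simp add: cz_def complex_eq_iff)

lemma cnj_cz_eq: "cnj (cz z) = of_real (fst z) + - \<i> * of_real (snd z)"
  by (simp add: cz_def complex_eq_iff)

lemma continuous_cz [continuous_intros]: "continuous_on A cz"
  unfolding cz_eq[abs_def] by (intro continuous_intros)

lemma Gaussian_power: "Re (\<i> ^ j) \<in> \<int> \<and> Im (\<i> ^ j) \<in> \<int>"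
  by (induction j) auto

lemma Gaussian_power_neg: "Re ((- \<i>) ^ j) \<in> \<int> \<and> Im ((- \<i>) ^ j) \<in> \<int>"
  by (induction j) auto

lemma Im_ii_power_even: "even j \<Longrightarrow> Im (\<i> ^ j) = 0"
  by (auto elim!: evenE simp: power_mult)

lemma binomial_product:
  fixes x y u v :: "'a :: comm_semiring_1"
  shows "(x + u * y) ^ p * (x + v * y) ^ q = (\<Sum>k\<le>p. \<Sum>l\<le>q.
    of_nat (p choose k) * of_nat (q choose l) * (u ^ k * v ^ l) * (x ^ (p - k + (q - l)) * y ^ (k + l)))"
  unfolding add.commute[of x] binomial_ring sum_product
  by (intro sum.cong refl) (simp only: power_mult_distrib power_add mult_ac)

text \<open>The rotation field multiplies z^p by \<i> p, because z = x + \<i>y. In the binomial expansion of z^p, the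
\<partial>/\<partial>y terms resum to \<i> p x z^(p-1) and the \<partial>/\<partial>x terms to p y z^(p-1).\<close>
lemma rotation_derivative_power:
  fixes x y :: complex
  shows "(\<Sum>j\<le>p. of_nat (p choose j) * \<i> ^ j *
      (of_nat j * (x ^ Suc (p - j) * y ^ (j - 1)) - of_nat (p - j) * (x ^ (p - j - 1) * y ^ Suc j)))
    = \<i> * of_nat p * (x + \<i> * y) ^ p"
proof (cases p)
  case (Suc n)
  have 1: "(\<Sum>j\<le>p. of_nat (p choose j) * \<i> ^ j * (of_nat j * (x ^ Suc (p - j) * y ^ (j - 1)))) =
     \<i> * of_nat p * x * (x + \<i> * y) ^ n"
  proof -
    have "(\<Sum>j\<le>p. of_nat (p choose j) * \<i> ^ j * (of_nat j * (x ^ Suc (p - j) * y ^ (j - 1)))) =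
      (\<Sum>k\<le>n. of_nat (Suc k * (p choose Suc k)) * \<i> ^ Suc k * (x ^ Suc (n - k) * y ^ k))"
      unfolding Suc sum.atMost_Suc_shift
      by (simp add: mult_ac del: of_nat_Suc binomial_Suc_Suc mult_Suc)
    also have "\<dots> = (\<Sum>k\<le>n. \<i> * of_nat p * x * (of_nat (n choose k) * (\<i> * y) ^ k * x ^ (n - k)))"
      unfolding Suc Suc_times_binomial
      by (simp add: power_mult_distrib mult_ac del: of_nat_Suc mult_Suc)
    also have "\<dots> = \<i> * of_nat p * x * (x + \<i> * y) ^ n"
      unfolding sum_distrib_left[symmetric] binomial_ring[symmetric] by (simp add: add.commute)
    finally show ?thesis .
  qed
  have 2: "(\<Sum>j\<le>p. of_nat (p choose j) * \<i> ^ j * (of_nat (p - j) * (x ^ (p - j - 1) * y ^ Suc j))) =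
     of_nat p * y * (x + \<i> * y) ^ n"
  proof -
    have "(\<Sum>j\<le>p. of_nat (p choose j) * \<i> ^ j * (of_nat (p - j) * (x ^ (p - j - 1) * y ^ Suc j))) =
      (\<Sum>k\<le>n. of_nat ((p - k) * (p choose k)) * \<i> ^ k * (x ^ (n - k) * y ^ Suc k))"
      unfolding Suc sum.atMost_Suc by (simp add: mult_ac)
    also have "\<dots> = (\<Sum>k\<le>n. of_nat p * y * (of_nat (n choose k) * (\<i> * y) ^ k * x ^ (n - k)))"
    proof (rule sum.cong)
      fix k
      have "(p - k) * (p choose k) = p * (n choose k)"
        using binomial_absorb_comp[of p k] by (simp add: Suc)
      then show "of_nat ((p - k) * (p choose k)) * \<i> ^ k * (x ^ (n - k) * y ^ Suc k) =
        of_nat p * y * (of_nat (n choose k) * (\<i> * y) ^ k * x ^ (n - k))"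
        by (simp only: of_nat_mult) (simp add: power_mult_distrib mult_ac)
    qed simp
    also have "\<dots> = of_nat p * y * (x + \<i> * y) ^ n"
      unfolding sum_distrib_left[symmetric] binomial_ring[symmetric] by (simp add: add.commute)
    finally show ?thesis .
  qed
  have "\<i> * of_nat p * x * (x + \<i> * y) ^ n - of_nat p * y * (x + \<i> * y) ^ n =
    \<i> * of_nat p * (x + \<i> * y) ^ Suc n"
    by (simp add: algebra_simps)
  then show ?thesis
    unfolding right_diff_distrib sum_subtractf 1 2 by (simp only: Suc)
qed simp

text \<open>The imaginary part of the preceding identity: p Re z^p is the derivative of Im z^p. For even p the
powers of y with nonzero coefficient in Im z^p are odd and lie strictly between 0 and p, so both
variables occur in every monomial.\<close>
lemma Re_cz_power_rot:
  assumes "even p"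
  shows "real p * Re (cz z ^ p) =
    (\<Sum>j | j < p \<and> odd j. real (p choose j) * Im (\<i> ^ j) * rot_monomial (p - j - 1) (j - 1) z)"
proof -
  let ?t = "\<lambda>j. real j * (fst z ^ Suc (p - j) * snd z ^ (j - 1)) -
    real (p - j) * (fst z ^ (p - j - 1) * snd z ^ Suc j)"
  have "\<i> * of_nat p * cz z ^ p = (\<Sum>j\<le>p. of_nat (p choose j) * \<i> ^ j * of_real (?t j))"
    unfolding cz_eq rotation_derivative_power[symmetric] by simp
  then have "Im (\<i> * of_nat p * cz z ^ p) = (\<Sum>j\<le>p. real (p choose j) * Im (\<i> ^ j) * ?t j)"
    by (simp del: of_real_diff of_real_mult add: Im_sum)
  moreover have "Im (\<i> * of_nat p * cz z ^ p) = real p * Re (cz z ^ p)" by simp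
  moreover have "(\<Sum>j\<le>p. real (p choose j) * Im (\<i> ^ j) * ?t j) =
    (\<Sum>j | j < p \<and> odd j. real (p choose j) * Im (\<i> ^ j) * ?t j)"
    by (rule sum.mono_neutral_right) (use assms in \<open>auto simp: Im_ii_power_even le_less\<close>)
  moreover have "\<dots> = (\<Sum>j | j < p \<and> odd j. real (p choose j) * Im (\<i> ^ j) * rot_monomial (p - j - 1) (j - 1) z)"
  proof (rule sum.cong)
    fix j assume "j \<in> {j. j < p \<and> odd j}"
    then have "j = Suc (j - 1)" "p - j = Suc (p - j - 1)" by (auto simp: odd_pos)
    then have "?t j = rot_monomial (p - j - 1) (j - 1) z"
      unfolding rot_monomial_def by (metis Suc_1 add_2_eq_Suc' )
    then show "real (p choose j) * Im (\<i> ^ j) * ?t j =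
      real (p choose j) * Im (\<i> ^ j) * rot_monomial (p - j - 1) (j - 1) z" by simp
  qed simp
  ultimately show ?thesis by simp
qed

text \<open>The integrand of bidegree (p, q) equals \<rho>^((p+q)/2) cos ((p-q) \<theta>) in polar coordinates.\<close>
definition radial_integral :: "nat \<Rightarrow> nat \<Rightarrow> real" where
  "radial_integral p q = weighted_integral (\<lambda>z. Re (cz z ^ p * cnj (cz z) ^ q))"

lemma radial_integral_commute: "radial_integral p q = radial_integral q p"
proof -
  have "Re (w ^ p * cnj w ^ q) = Re (w ^ q * cnj w ^ p)" for w
  proof -
    have "w ^ q * cnj w ^ p = cnj (w ^ p * cnj w ^ q)" by (simp add: mult.commute)
    then show ?thesis by (simp only: complex_cnj(1) cnj.sel)
  qed
  then show ?thesis by (simp add: radial_integral_def)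
qed

lemma radial_integral_Suc_Suc:
  "radial_integral (Suc p) (Suc q) =
    radial_integral p q - Delta_integral (\<lambda>z. Re (cz z ^ p * cnj (cz z) ^ q))"
proof -
  have "Re (cz z ^ Suc p * cnj (cz z) ^ Suc q) =
    Re (cz z ^ p * cnj (cz z) ^ q) * ((fst z)\<^sup>2 + (snd z)\<^sup>2)" for z
  proof -
    have "cz z ^ Suc p * cnj (cz z) ^ Suc q = (cz z ^ p * cnj (cz z) ^ q) * (cz z * cnj (cz z))"
      by (simp add: mult_ac)
    also have "cz z * cnj (cz z) = of_real ((fst z)\<^sup>2 + (snd z)\<^sup>2)"
      by (simp add: complex_mult_cnj cz_def)
    finally have "Re (cz z ^ Suc p * cnj (cz z) ^ Suc q) =
      Re ((cz z ^ p * cnj (cz z) ^ q) * of_real ((fst z)\<^sup>2 + (snd z)\<^sup>2))" by (rule arg_cong)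
    also have "\<dots> = Re (cz z ^ p * cnj (cz z) ^ q) * ((fst z)\<^sup>2 + (snd z)\<^sup>2)"
      unfolding times_complex.sel(1) by (simp del: of_real_add of_real_power)
    finally show ?thesis .
  qed
  then show ?thesis
    unfolding radial_integral_def
    by (simp only:) (intro weighted_integral_radius continuous_intros)
qed

text \<open>The integrand is a form of degree d with integer coefficients, since the coefficients of
(x + \<i>y)^p (x - \<i>y)^q are Gaussian integers; each of its monomials integrates to a Beta value
divided by d + 2.\<close>
lemma lcm_upto_times_Delta_integral:
  assumes "p + q = d"
  shows "real ((d + 2) * lcm_upto (d + 1)) * Delta_integral (\<lambda>z. Re (cz z ^ p * cnj (cz z) ^ q)) \<in> \<int>"
proof -
  define c where "c k l = real (p choose k) * real (q choose l) * Re (\<i> ^ k * (- \<i>) ^ l)" for k l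
  have c: "c k l \<in> \<int>" for k l
    unfolding c_def times_complex.simps using Gaussian_power[of k] Gaussian_power_neg[of l]
    by (intro Ints_mult Ints_diff) auto
  have expand: "Re (cz z ^ p * cnj (cz z) ^ q) =
    (\<Sum>k\<le>p. \<Sum>l\<le>q. c k l * (fst z ^ (p - k + (q - l)) * snd z ^ (k + l)))" for z
  proof -
    have "cz z ^ p * cnj (cz z) ^ q = (\<Sum>k\<le>p. \<Sum>l\<le>q.
        of_real (real (p choose k) * real (q choose l)) * (\<i> ^ k * (- \<i>) ^ l) *
        of_real (fst z ^ (p - k + (q - l)) * snd z ^ (k + l)))"
      unfolding cnj_cz_eq
      unfolding cz_eq binomial_product by simp
    then show ?thesis by (simp add: Re_sum c_def del: of_real_mult of_real_power) 
  qed
  have "Delta_integral (\<lambda>z. Re (cz z ^ p * cnj (cz z) ^ q)) =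
    (\<Sum>k\<le>p. \<Sum>l\<le>q. c k l * (beta_nat (p - k + (q - l)) (k + l) / real (p - k + (q - l) + (k + l) + 2)))"
    unfolding expand
    by (simp add: Delta_integral_sum Delta_integral_mult Delta_integral_monomial continuous_intros)
  also have "\<dots> = (\<Sum>k\<le>p. \<Sum>l\<le>q. c k l * (beta_nat (p - k + (q - l)) (k + l) / real (d + 2)))"
    using assms by (intro sum.cong refl) (auto simp: add_ac)
  finally have expansion: "Delta_integral (\<lambda>z. Re (cz z ^ p * cnj (cz z) ^ q)) =
    (\<Sum>k\<le>p. \<Sum>l\<le>q. c k l * (beta_nat (p - k + (q - l)) (k + l) / real (d + 2)))" .
  have eq: "real ((d + 2) * lcm_upto (d + 1)) * Delta_integral (\<lambda>z. Re (cz z ^ p * cnj (cz z) ^ q)) =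
    (\<Sum>k\<le>p. \<Sum>l\<le>q. c k l * (real (lcm_upto (d + 1)) * beta_nat (p - k + (q - l)) (k + l)))"
    unfolding expansion sum_distrib_left of_nat_mult
    by (intro sum.cong refl) (simp del: of_nat_add)
  show ?thesis
    unfolding eq by (intro Ints_sum Ints_mult c lcm_upto_times_beta_nat) (use assms in auto)
qed

text \<open>Here p = 2n satisfies 2p L_p = 4n L_(2n). The factor p comes from writing Re z^p as a derivative and
the factor 2 from the weight 1/(2xy) on the hypotenuse.\<close>
lemma radial_integral_power:
  "real (4 * n * lcm_upto (2 * n)) * radial_integral (2 * n) 0 \<in> \<int>"
proof -
  define p where "p = 2 * n"
  let ?A = "{j. j < p \<and> odd j}"
  let ?L = "real (lcm_upto p)"
  let ?c = "\<lambda>j. real (p choose j) * Im (\<i> ^ j)"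
  have "real p * radial_integral p 0 =
    weighted_integral (\<lambda>z. \<Sum>j\<in>?A. ?c j * rot_monomial (p - j - 1) (j - 1) z)"
    unfolding radial_integral_def weighted_integral_mult[symmetric]
    using Re_cz_power_rot[of p] by (simp add: p_def)
  also have "\<dots> = (\<Sum>j\<in>?A. ?c j * ((beta_nat (Suc (p - j - 1)) (j - 1) -
      beta_nat (p - j - 1) (Suc (j - 1))) / 2))"
    by (simp add: weighted_integral_sum weighted_integral_mult weighted_integral_rot_monomial
        continuous_intros del: Suc_pred Suc_diff_1)
  finally have radial: "real p * radial_integral p 0 = (\<Sum>j\<in>?A. ?c j *
    ((beta_nat (Suc (p - j - 1)) (j - 1) - beta_nat (p - j - 1) (Suc (j - 1))) / 2))" .
  have eq: "2 * ?L * (real p * radial_integral p 0) =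
    (\<Sum>j\<in>?A. ?c j * (?L * beta_nat (Suc (p - j - 1)) (j - 1) - ?L * beta_nat (p - j - 1) (Suc (j - 1))))"
    unfolding radial sum_distrib_left by (intro sum.cong refl) (simp add: field_simps)
  have "2 * ?L * (real p * radial_integral p 0) \<in> \<int>"
    unfolding eq
  proof (rule Ints_sum)
    fix j assume "j \<in> ?A"
    then have j: "1 \<le> j" "j < p" by (auto simp: Suc_le_eq odd_pos)
    have "?L * beta_nat (Suc (p - j - 1)) (j - 1) \<in> \<int>"
      by (rule lcm_upto_times_beta_nat) (use j in linarith)
    moreover have "?L * beta_nat (p - j - 1) (Suc (j - 1)) \<in> \<int>"
      by (rule lcm_upto_times_beta_nat) (use j in linarith)
    ultimately show "?c j * (?L * beta_nat (Suc (p - j - 1)) (j - 1) -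
        ?L * beta_nat (p - j - 1) (Suc (j - 1))) \<in> \<int>"
      by (rule Ints_mult[OF _ Ints_diff, rotated]) (use Gaussian_power[of j] in auto)
  qed
  then show ?thesis by (simp add: p_def mult_ac)
qed

lemma radial_integral_power_lattice:
"radial_integral (2 * n) 0 \<in> catalan_lattice (4 * lcm_upto (2 * n) * lcm_upto n) 1"
proof (cases "n = 0")
  case True
  then show ?thesis
    by (intro catalan_latticeI[of _ 0 1]) (auto simp: radial_integral_def weighted_integral_1)
next
  case False
  then have "4 * n * lcm_upto (2 * n) dvd 4 * lcm_upto (2 * n) * lcm_upto n"
    using dvd_lcm_upto[of n n] by (simp add: mult_ac mult_dvd_mono)
  with False show ?thesis
    by (intro catalan_lattice_rational Ints_of_nat_dvd_mult[OF _ radial_integral_power]) auto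
qed

text \<open>In the step from degree 2m to 2m + 2 the correction has denominator (2m + 2) L_(2m+1); this divides
4 L_(2m+2) L_(m+1) because m + 1 divides L_(m+1).\<close>
lemma radial_integral_lattice:
  assumes "p + q = 2 * n"
  shows "radial_integral p q \<in> catalan_lattice (4 * lcm_upto (2 * n) * lcm_upto n) 1"
  using assms
proof (induction q arbitrary: p n)
  case 0
  then show ?case using radial_integral_power_lattice[of n] by simp
next
  case (Suc q)
  show ?case
  proof (cases p)
    case 0
    then show ?thesis using radial_integral_power_lattice[of n] Suc.prems by (simp add: radial_integral_commute)
  next
    case (Suc p')
    then obtain m where n: "n = Suc m" and m: "p' + q = 2 * m"
      using \<open>p + Suc q = 2 * n\<close> by (cases n) auto
    let ?u = "4 * lcm_upto (2 * n) * lcm_upto n"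
    have "4 * lcm_upto (2 * m) * lcm_upto m dvd ?u"
      unfolding n by (intro mult_dvd_mono lcm_upto_dvd_mono) auto
    then have "radial_integral p' q \<in> catalan_lattice ?u 1"
      using catalan_lattice_mono[OF Suc.IH[OF m]] by simp
    moreover have "(2 * m + 2) * lcm_upto (2 * m + 1) dvd ?u"
    proof -
      have "Suc m dvd lcm_upto n" unfolding n by (intro dvd_lcm_upto) auto
      moreover have "lcm_upto (2 * m + 1) dvd lcm_upto (2 * n)"
        unfolding n by (intro lcm_upto_dvd_mono) auto
      ultimately have "Suc m * lcm_upto (2 * m + 1) dvd lcm_upto n * lcm_upto (2 * n)"
        by (rule mult_dvd_mono)
      then have "2 * (Suc m * lcm_upto (2 * m + 1)) dvd 4 * (lcm_upto n * lcm_upto (2 * n))"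
        by (rule mult_dvd_mono[rotated]) simp
      then show ?thesis by (simp add: algebra_simps)
    qed
    then have "Delta_integral (\<lambda>z. Re (cz z ^ p' * cnj (cz z) ^ q)) \<in> catalan_lattice ?u 1"
      by (intro catalan_lattice_rational Ints_of_nat_dvd_mult[OF _ lcm_upto_times_Delta_integral[OF m]])
    ultimately show ?thesis
      unfolding \<open>p = Suc p'\<close> radial_integral_Suc_Suc by (rule catalan_lattice_diff)
  qed
qed

text \<open>The powers of 2 are the price for 2x = z + z' and 2\<i>y = z - z'. As j is even, \<i>^j is a sign, so the
left-hand side stays real and taking real parts keeps integer coefficients.\<close>
lemma weighted_integral_even_monomial:
  assumes "i + j = 2 * n" "even j"
  shows "weighted_integral (\<lambda>z. fst z ^ i * snd z ^ j) \<in>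
    catalan_lattice (2 ^ (2 * n) * (4 * lcm_upto (2 * n) * lcm_upto n)) (2 ^ (2 * n))"
proof -
  define c where "c k l = (-1) ^ (j div 2) * real (i choose k) * real (j choose l) * (-1) ^ l" for k l
  have c: "c k l \<in> \<int>" for k l unfolding c_def by auto
  have "2 ^ (2 * n) * (fst z ^ i * snd z ^ j) =
     (\<Sum>k\<le>i. \<Sum>l\<le>j. c k l * Re (cz z ^ (i - k + (j - l)) * cnj (cz z) ^ (k + l)))" for z
  proof -
    have x: "2 * of_real (fst z) = cz z + 1 * cnj (cz z)"
      and y: "2 * \<i> * of_real (snd z) = cz z + - 1 * cnj (cz z)"
      by (simp_all add: complex_eq_iff cz_def)
    have i2: "\<i> ^ j = (-1) ^ (j div 2)" using assms(2) by (metis dvd_mult_div_cancel power2_i power_mult)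
    have "2 ^ i * 2 ^ j = (2 :: complex) ^ (2 * n)" by (simp flip: assms(1) power_add)
    then have "of_real (2 ^ (2 * n) * (fst z ^ i * snd z ^ j)) =
      (-1) ^ (j div 2) * ((2 * of_real (fst z)) ^ i * (2 * \<i> * of_real (snd z)) ^ j)"
      by (simp add: power_mult_distrib i2 mult_ac flip: power_add)
    also have "\<dots> = (\<Sum>k\<le>i. \<Sum>l\<le>j. of_real (c k l) *
        (cz z ^ (i - k + (j - l)) * cnj (cz z) ^ (k + l)))"
      unfolding x y binomial_product sum_distrib_left
      by (intro sum.cong refl) (simp add: c_def mult_ac)
    finally have "Re (of_real (2 ^ (2 * n) * (fst z ^ i * snd z ^ j))) = Re (\<Sum>k\<le>i. \<Sum>l\<le>j.
      of_real (c k l) * (cz z ^ (i - k + (j - l)) * cnj (cz z) ^ (k + l)))" by (rule arg_cong)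
    then show ?thesis by (simp only: Re_complex_of_real Re_sum) simp
  qed
  then have "2 ^ (2 * n) * weighted_integral (\<lambda>z. fst z ^ i * snd z ^ j) =
    weighted_integral (\<lambda>z. \<Sum>k\<le>i. \<Sum>l\<le>j. c k l * Re (cz z ^ (i - k + (j - l)) * cnj (cz z) ^ (k + l)))"
    unfolding weighted_integral_mult[symmetric] by simp
  also have "\<dots> = (\<Sum>k\<le>i. \<Sum>l\<le>j. c k l * radial_integral (i - k + (j - l)) (k + l))"
    unfolding radial_integral_def
    by (simp add: weighted_integral_sum weighted_integral_mult continuous_intros del: times_complex.sel)
  also have "\<dots> \<in> catalan_lattice (4 * lcm_upto (2 * n) * lcm_upto n) 1"
    by (intro catalan_lattice_sum catalan_lattice_mult_Ints c radial_integral_lattice)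
       (use assms in auto)
  finally show ?thesis
    using catalan_lattice_divide[of "2 ^ (2 * n)" _ "4 * lcm_upto (2 * n) * lcm_upto n" 1] by simp
qed

section \<open>Evaluating integer polynomials and the automorphism\<close>

lemma nonzero_coeff_total_degree:
  assumes "coeff (coeff F j) i \<noteq> 0"
  shows "i + j \<le> total_degree F"
proof -
  let ?S = "{i + j |i j. coeff (coeff F j) i \<noteq> 0}"
  have "?S \<subseteq> (\<lambda>(i, j). i + j) ` (\<Union>j\<le>degree F. {..degree (coeff F j)} \<times> {j})"
  proof
    fix s assume "s \<in> ?S"
    then obtain i j where s: "s = i + j" and nz: "coeff (coeff F j) i \<noteq> 0" by blast
    then have "i \<le> degree (coeff F j)" "coeff F j \<noteq> 0"
      by (auto intro: le_degree)
    then have "j \<le> degree F" by (auto intro: le_degree)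
    with \<open>i \<le> degree (coeff F j)\<close> show "s \<in> (\<lambda>(i, j). i + j) ` (\<Union>j\<le>degree F. {..degree (coeff F j)} \<times> {j})"
      by (auto simp: s intro!: image_eqI[of _ _ "(i, j)"])
  qed
  then have "finite ?S" by (rule finite_subset) auto
  then show ?thesis
    unfolding total_degree_def using assms by (intro Max_ge) auto
qed

lemma poly_map_poly_of_int_sum:
  fixes x :: "'a::comm_ring_1"
  assumes "f 0 = 0" "\<And>i. N < i \<Longrightarrow> coeff p i = 0"
  shows "poly (map_poly f p) x = (\<Sum>i\<le>N. f (coeff p i) * x ^ i)"
proof -
  have "degree (map_poly f p) \<le> N"
    by (rule degree_le) (auto simp: coeff_map_poly assms)
  then have "poly (map_poly f p) x = (\<Sum>i\<le>N. coeff (map_poly f p) i * x ^ i)"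
    unfolding poly_altdef by (intro sum.mono_neutral_left) (auto intro!: le_degree)
  then show ?thesis by (simp add: coeff_map_poly assms)
qed

lemma eval2_sum:
  fixes a b :: "'a::comm_ring_1"
  assumes "total_degree F \<le> N"
  shows "eval2 F a b = (\<Sum>j\<le>N. \<Sum>i\<le>N. of_int (coeff (coeff F j) i) * (a ^ i * b ^ j))"
proof -
  have zero: "coeff (coeff F j) i = 0" if "N < i \<or> N < j" for i j
    using nonzero_coeff_total_degree[of F j i] assms that by force
  have "eval2 F a b = (\<Sum>j\<le>N. poly (map_poly of_int (coeff F j)) a * b ^ j)"
    unfolding eval2_def
    by (rule poly_map_poly_of_int_sum) (auto intro!: poly_eqI simp: zero)
  also have "\<dots> = (\<Sum>j\<le>N. (\<Sum>i\<le>N. of_int (coeff (coeff F j) i) * a ^ i) * b ^ j)"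
    by (intro sum.cong refl arg_cong2[where f = "(*)"] poly_map_poly_of_int_sum) (auto simp: zero)
  finally show ?thesis by (simp add: sum_distrib_right mult.assoc)
qed

lemma eval2_pCons:
  "eval2 (pCons p F) a b = poly (map_poly of_int p) a + b * eval2 F a (b :: 'a::comm_ring_1)"
  unfolding eval2_def by (simp add: map_poly_pCons)

lemma eval2_0: "eval2 0 a b = 0"
  by (simp add: eval2_def)

lemma eval2_add: "eval2 (F + H) a b = eval2 F a b + eval2 H a (b :: 'a::comm_ring_1)"
proof -
  let ?N = "max (total_degree (F + H)) (max (total_degree F) (total_degree H))"
  show ?thesis
    by (simp add: eval2_sum[where N = ?N] sum.distrib distrib_right)
qed

lemma eval2_diff: "eval2 (F - H) a b = eval2 F a b - eval2 H a (b :: 'a::comm_ring_1)"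
  using eval2_add[of "F - H" H a b] by simp

lemma eval2_var_x_mult: "eval2 (var_x * F) a b = a * eval2 F a (b :: 'a::comm_ring_1)"
  unfolding var_x_def
  by (induction F) (simp_all add: eval2_pCons eval2_0 map_poly_pCons algebra_simps)

lemma eval2_var_y_mult: "eval2 (var_y * F) a b = b * eval2 F a (b :: 'a::comm_ring_1)"
  by (simp add: var_y_def eval2_pCons)

lemma eval2_of_int: "eval2 (of_int k) a b = (of_int k :: 'a::comm_ring_1)"
proof -
  have "(of_int k :: int poly poly) = [:[:k:]:]"
    by (simp add: of_int_poly)
  then show ?thesis by (simp add: eval2_pCons eval2_0 map_poly_pCons)
qed

lemma eval2_sigma_aut: "eval2 (sigma_aut F) a b = eval2 F (- b) (a :: 'a::comm_ring_1)"
proof (induction F)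
  case 0
  then show ?case by (simp add: sigma_aut_def eval2_0)
next
  case (pCons p F)
  have "eval2 (poly (map_poly of_int p) (- var_y)) a b = poly (map_poly of_int p) (- b)"
    by (induction p) (simp_all add: map_poly_pCons eval2_0 eval2_diff eval2_var_y_mult eval2_of_int)
  moreover have "sigma_aut (pCons p F) = poly (map_poly of_int p) (- var_y) + var_x * sigma_aut F"
    unfolding sigma_aut_def by (rule eval2_pCons)
  ultimately show ?case
    by (simp add: eval2_add eval2_var_x_mult eval2_pCons pCons.IH)
qed

section \<open>Invariant polynomials\<close>

lemma weighted_integral_swap:
  assumes "continuous_on UNIV f"
  shows "weighted_integral (\<lambda>z. f (snd z, fst z)) = weighted_integral f"
proof -
  let ?g = "\<lambda>z. indicator Delta z *\<^sub>R (f z * circle_kernel z)"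
  have [measurable]: "f \<in> borel_measurable borel"
    using assms by (rule borel_measurable_continuous_onI)
  have "?g \<in> borel_measurable borel" by measurable
  then have "?g \<in> borel_measurable (lborel \<Otimes>\<^sub>M lborel)"
    by (simp add: lborel_prod)
  from lborel_pair.integral_product_swap[OF this]
  have "(LINT z|lborel. ?g (snd z, fst z)) = (LINT z|lborel. ?g z)"
    by (simp add: lborel_prod case_prod_beta')
  moreover have "(LINT z|lborel. ?g (snd z, fst z)) =
    (LINT z|lborel. indicator Delta z *\<^sub>R (f (snd z, fst z) * circle_kernel z))"
    by (rule Bochner_Integration.integral_cong)
       (auto simp: indicator_def Delta_eq circle_kernel_def algebra_simps)
  ultimately show ?thesis
    by (simp add: weighted_integral_def set_lebesgue_integral_def)
qed

text \<open>Invariance turns a single sign change into the exchange of the variables, which preserves both the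
triangle and the weight; hence all four sign variants have the same weighted integral.\<close>
lemma weighted_integral_invariant:
  assumes cont: "continuous_on UNIV (\<lambda>z. f (fst z) (snd z))"
    and inv: "\<And>x y. f x y = f (- y) x"
  shows "4 * weighted_integral (\<lambda>z. f (fst z) (snd z)) = weighted_integral (\<lambda>z.
    f (fst z) (snd z) + f (- fst z) (snd z) + f (fst z) (- snd z) + f (- fst z) (- snd z))"
proof -
  have "continuous_on UNIV (\<lambda>z :: real \<times> real. (snd z, fst z))"
    by (intro continuous_intros)
  from continuous_on_compose2[OF cont this]
  have swapped: "continuous_on UNIV (\<lambda>z. f (snd z) (fst z))" by simp
  have "f (- x) y = f y x" "f x (- y) = f y x" "f (- x) (- y) = f x y" for x y
    using inv by (metis minus_minus)+
  then have "weighted_integral (\<lambda>z.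
      f (fst z) (snd z) + f (- fst z) (snd z) + f (fst z) (- snd z) + f (- fst z) (- snd z)) =
    weighted_integral (\<lambda>z. 2 * (f (fst z) (snd z) + f (snd z) (fst z)))"
    by (simp add: algebra_simps)
  also have "\<dots> = 2 * (weighted_integral (\<lambda>z. f (fst z) (snd z)) + weighted_integral (\<lambda>z. f (snd z) (fst z)))"
    unfolding weighted_integral_mult
    using weighted_integral_add[OF cont swapped] by simp
  also have "weighted_integral (\<lambda>z. f (snd z) (fst z)) = weighted_integral (\<lambda>z. f (fst z) (snd z))"
    using weighted_integral_swap[OF cont] by simp
  finally show ?thesis by simp
qed

lemma sign_average_monomial:
  fixes x y :: real
  shows "x ^ i * y ^ j + (- x) ^ i * y ^ j + x ^ i * (- y) ^ j + (- x) ^ i * (- y) ^ j =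
    (if even i \<and> even j then 4 * (x ^ i * y ^ j) else 0)"
  by (cases "even i"; cases "even j") auto

lemma weighted_integral_sigma_invariant:
  assumes inv: "sigma_aut F = F" and deg: "total_degree F = N"
  shows "weighted_integral (\<lambda>z. eval2 F (fst z) (snd z)) \<in>
    catalan_lattice (2 ^ (N + 2) * lcm_upto N * lcm_upto (N div 2)) (2 ^ N)"
proof -
  define c where "c i j = real_of_int (coeff (coeff F j) i)" for i j
  have eval: "eval2 F x y = (\<Sum>j\<le>N. \<Sum>i\<le>N. c i j * (x ^ i * y ^ j))" for x y :: real
    unfolding c_def using deg by (intro eval2_sum) simp
  have cont: "continuous_on UNIV (\<lambda>z :: real \<times> real. eval2 F (fst z) (snd z))"
    unfolding eval by (intro continuous_intros)
  have sym: "eval2 F x y = eval2 F (- y) x" for x y :: real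
    using eval2_sigma_aut[of F x y] by (simp add: inv)
  have "4 * weighted_integral (\<lambda>z. eval2 F (fst z) (snd z)) = weighted_integral (\<lambda>z.
     \<Sum>j\<le>N. \<Sum>i\<le>N. (if even i \<and> even j then 4 * c i j else 0) * (fst z ^ i * snd z ^ j))"
  proof -
    have "eval2 F x y + eval2 F (- x) y + eval2 F x (- y) + eval2 F (- x) (- y) =
      (\<Sum>j\<le>N. \<Sum>i\<le>N. (if even i \<and> even j then 4 * c i j else 0) * (x ^ i * y ^ j))" for x y :: real
    proof -
      have "eval2 F x y + eval2 F (- x) y + eval2 F x (- y) + eval2 F (- x) (- y) =
        (\<Sum>j\<le>N. \<Sum>i\<le>N. c i j * (x ^ i * y ^ j + (- x) ^ i * y ^ j + x ^ i * (- y) ^ j + (- x) ^ i * (- y) ^ j))"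
        unfolding eval sum.distrib[symmetric] distrib_left[symmetric] ..
      also have "\<dots> = (\<Sum>j\<le>N. \<Sum>i\<le>N. (if even i \<and> even j then 4 * c i j else 0) * (x ^ i * y ^ j))"
        unfolding sign_average_monomial by (intro sum.cong refl) simp
      finally show ?thesis .
    qed
    then show ?thesis
      unfolding weighted_integral_invariant[OF cont sym] by simp
  qed
  also have "\<dots> = 4 * (\<Sum>j\<le>N. \<Sum>i\<le>N. (if even i \<and> even j then c i j else 0) *
      weighted_integral (\<lambda>z. fst z ^ i * snd z ^ j))"
    by (simp add: weighted_integral_sum weighted_integral_mult continuous_intros sum_distrib_left)
       (intro sum.cong refl, simp)
  finally have "weighted_integral (\<lambda>z. eval2 F (fst z) (snd z)) =
    (\<Sum>j\<le>N. \<Sum>i\<le>N. (if even i \<and> even j then c i j else 0) *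
      weighted_integral (\<lambda>z. fst z ^ i * snd z ^ j))" by simp
  also have "\<dots> \<in> catalan_lattice (2 ^ (N + 2) * lcm_upto N * lcm_upto (N div 2)) (2 ^ N)"
  proof (intro catalan_lattice_sum)
    fix i j
    show "(if even i \<and> even j then c i j else 0) * weighted_integral (\<lambda>z. fst z ^ i * snd z ^ j) \<in>
      catalan_lattice (2 ^ (N + 2) * lcm_upto N * lcm_upto (N div 2)) (2 ^ N)"
    proof (cases "even i \<and> even j \<and> c i j \<noteq> 0")
      case True
      then have "i + j \<le> N"
        using nonzero_coeff_total_degree[of F j i] deg by (simp add: c_def)
      from True obtain n where n: "i + j = 2 * n" by (metis even_add evenE)
      with \<open>i + j \<le> N\<close> have "2 * n \<le> N" "n \<le> N div 2" by auto
      then have "2 ^ (2 * n) * (4 * lcm_upto (2 * n) * lcm_upto n) dvd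
        2 ^ N * (4 * lcm_upto N * lcm_upto (N div 2))"
        by (intro mult_dvd_mono lcm_upto_dvd_mono le_imp_power_dvd) auto
      then have "2 ^ (2 * n) * (4 * lcm_upto (2 * n) * lcm_upto n) dvd
        2 ^ (N + 2) * lcm_upto N * lcm_upto (N div 2)"
        by (simp add: mult_ac)
      moreover have "(2 :: nat) ^ (2 * n) dvd 2 ^ N"
        using \<open>2 * n \<le> N\<close> by (rule le_imp_power_dvd)
      ultimately have "weighted_integral (\<lambda>z. fst z ^ i * snd z ^ j) \<in>
        catalan_lattice (2 ^ (N + 2) * lcm_upto N * lcm_upto (N div 2)) (2 ^ N)"
        using weighted_integral_even_monomial[OF n] True catalan_lattice_mono by blast
      then show ?thesis
        by (intro catalan_lattice_mult_Ints) (auto simp: c_def)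
    next
      case False
      then show ?thesis by (auto intro!: catalan_lattice_rational)
    qed
  qed
  finally show ?thesis .
qed

theorem theorem8p3p1:
  fixes F :: "int poly poly" and N :: nat
  assumes "sigma_aut F = F" and "total_degree F = N"
  shows "set_integrable lborel Delta (\<lambda>(x, y). eval2 F x y / (1 - x\<^sup>2 - y\<^sup>2)) \<and>
    (\<exists>a b :: real. a \<in> \<rat> \<and> b \<in> \<rat> \<and>
      (LINT (x, y):Delta|lborel. eval2 F x y / (1 - x\<^sup>2 - y\<^sup>2)) = a + b * Catalan_G \<and>
      2 ^ N * b \<in> \<int> \<and>
      2 ^ (N + 2) * real (lcm_upto N) * real (lcm_upto (N div 2)) * a \<in> \<int>)"
proof -
  have integrand: "(\<lambda>(x, y). eval2 F x y / (1 - x\<^sup>2 - y\<^sup>2)) =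
    (\<lambda>z. eval2 F (fst z) (snd z) * circle_kernel z)"
    by (auto simp: circle_kernel_def)
  have "continuous_on UNIV (\<lambda>z :: real \<times> real. eval2 F (fst z) (snd z))"
    unfolding eval2_sum[OF order_refl] by (intro continuous_intros)
  then have integrable: "set_integrable lborel Delta (\<lambda>(x, y). eval2 F x y / (1 - x\<^sup>2 - y\<^sup>2))"
    unfolding integrand by (rule weighted_integrable)
  let ?u = "2 ^ (N + 2) * lcm_upto N * lcm_upto (N div 2)"
  have rational: "x \<in> \<rat>" if "real u * x \<in> \<int>" "u > 0" for u x
  proof -
    have "x = real u * x / real u" using that(2) by simp
    then show ?thesis using that(1) by (metis Ints_subset_Rats Rats_divide Rats_of_nat subsetD)
  qed
  obtain a b where ab: "weighted_integral (\<lambda>z. eval2 F (fst z) (snd z)) = a + b * Catalan_G"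
    "real ?u * a \<in> \<int>" "real (2 ^ N) * b \<in> \<int>"
    using weighted_integral_sigma_invariant[OF assms] by (rule catalan_latticeE)
  have "a \<in> \<rat>" "b \<in> \<rat>"
    using ab(2,3) rational lcm_upto_pos by (metis mult_pos_pos pos2 zero_less_power)+
  moreover have "(LINT (x, y):Delta|lborel. eval2 F x y / (1 - x\<^sup>2 - y\<^sup>2)) = a + b * Catalan_G"
    unfolding integrand using ab(1) by (simp add: weighted_integral_def)
  ultimately show ?thesis
    using integrable ab(2,3) by auto
qed

end
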